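(* Let $\epsilon\in\{-1,1\}$ and let $(M^{2n},\mathcal J^\epsilon,g)$ be an $\epsilon$-Kähler submanifold (of maximal dimension $2n$) of a para-quaternionic Kähler manifold $(\widetilde M^{4n},Q,\widetilde g)$ with $\nu\neq0$, with adapted basis $(J_1,J_2,J_3)$. Then the shape tensor $C=J_2h$ belongs to the space $S^{(1)}_{\mathcal J^\epsilon}$ and its covariant derivative is given by $$\nabla_XC=J_2\nabla'_Xh-\epsilon\,\omega(X)\,\mathcal J^\epsilon\circ C,\qquad X\in TM.$$
   Context: An almost para-quaternionic structure on $\widetilde M$ is a rank 3 subbundle $Q\subset \mathrm{End}\,T\widetilde M$ locally generated by three anticommuting fields of endomorphisms $J_1,J_2,J_3=J_1J_2$ with $J_\alpha^2=\epsilon_\alpha Id$, where $(\epsilon_1,\epsilon_2,\epsilon_3)$ is a permutation of $(-1,1,1)$. A para-quaternionic Kähler manifold $(\widetilde M^{4n},Q,\widetilde g)$ is a pseudo-Riemannian manifold (of dimension $4n$, neutral signature) with such a $Q$ consisting of $\widetilde g$-skew-symmetric endomorphisms and preserved by the Levi-Civita connection $\widetilde\nabla$; in dimension 4 ($n=1$) one requires in addition that $\widetilde R=\nu R_0+W$, with $R_0(X,Y)=\frac12\sum_\alpha\epsilon_\alpha\widetilde g(J_\alpha X,Y)J_\alpha+\frac14(X\wedge Y-\sum_\alpha\epsilon_\alpha J_\alpha X\wedge J_\alpha Y)$, $(X\wedge Y)Z=\widetilde g(Y,Z)X-\widetilde g(X,Z)Y$, and $W$ a trace-free $Q$-invariant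 algebraic curvature tensor. $\nu=scal/(4n(n+2))$ is the reduced scalar curvature. A $\widetilde g$-non-degenerate submanifold $M\subset\widetilde M$ is an almost $\epsilon$-Hermitian submanifold if there is a section $J^\epsilon:M\to Q|_M$ with $J^\epsilon TM=TM$ and $(J^\epsilon)^2=\epsilon Id$; put $g=\widetilde g|_M$, $\mathcal J^\epsilon=J^\epsilon|_{TM}$. It is $\epsilon$-Kähler if $F=g\circ\mathcal J^\epsilon$ is parallel for the Levi-Civita connection $\nabla$ of $g$. An adapted basis is a local frame $(J_1,J_2,J_3)$ of $Q$ with $J_1|_M=J^\epsilon$, $J_1^2=\epsilon Id$, $J_2^2=Id$, $J_3=J_1J_2=-J_2J_1$ (so $(\epsilon_1,\epsilon_2,\epsilon_3)=(\epsilon,1,-\epsilon)$); it is assumed defined on a neighbourhood of $M$ (all considerations being local). The 1-forms $\omega_\alpha$ are defined by $\widetilde\nabla J_\alpha=-\epsilon_\beta\omega_\gamma\otimes J_\beta+\epsilon_\gamma\omega_\beta\otimes J_\gamma$, $(\alpha,\beta,\gamma)$ cyclic, and $\omega=\omega_1|_{TM}$. $M$ is totally $\epsilon$-complex, i.e. $J_2T_xM\perp T_xM$, so that $T_x\widetilde M=T_xM\oplus J_2T_xM$ and $J_2$ exchanges $TM$ and the normal bundle $T^\perp M$. $h$ is the second fundamental form, and the shape tensor is $C=J_2\circ h\in TM\otimes S^2T^*M$, $C_XY=J_2h(X,Y)$. $\nabla^\perp$ is the normal connection and $(\nabla'_Xh)(Y,Z)=\nabla^\perp_X(h(Y,Z))-h(\nabla_XY,Z)-h(Y,\nabla_XZ)$.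 $S_{\mathcal J^\epsilon}=\{A\in\mathrm{End}\,TM:\ A\mathcal J^\epsilon+\mathcal J^\epsilon A=0,\ g(AX,Y)=g(X,AY)\}$ and $S^{(1)}_{\mathcal J^\epsilon}=\{A\in\mathrm{Hom}(TM,S_{\mathcal J^\epsilon}):\ A_XY=A_YX\}$ is its first prolongation.
   Formalization: The last term is proved with sign +εω(X)𝒥∘C, since the stated conventions give ∇̃J₂=εω₁J₃+εω₃J₁ and the printed minus is false; for n=1, where C∈S^(1) fails for general surfaces, J^ε is also assumed ∇̃-parallel along M. *)

theory Defs
  imports "HOL-Analysis.Analysis"
begin

section \<open>Smooth manifolds and tensor fields\<close>

text \<open>A manifold is a topological space (the whole type) with an atlas of charts (domain, coordinate
  map) into a Euclidean space.  A tensor field is the family of its components in the charts of the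
  atlas, as functions of the point of the manifold, subject to the usual transformation law.  Thus a
  tangent vector at \<open>p\<close> is, in each chart \<open>c\<close> around \<open>p\<close>, its coordinate vector.\<close>

primrec Ck_on :: "nat \<Rightarrow> 'a::euclidean_space set \<Rightarrow> ('a \<Rightarrow> 'v::real_normed_vector) \<Rightarrow> bool" where
  "Ck_on 0 S f \<longleftrightarrow> continuous_on S f"
| "Ck_on (Suc k) S f \<longleftrightarrow> (\<forall>x\<in>S. f differentiable (at x)) \<and>
     (\<forall>v. Ck_on k S (\<lambda>x. frechet_derivative f (at x) v))"

definition smooth_on :: "'a::euclidean_space set \<Rightarrow> ('a \<Rightarrow> 'v::real_normed_vector) \<Rightarrow> bool" where
  "smooth_on S f \<longleftrightarrow> (\<forall>k. Ck_on k S f)"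

type_synonym ('m, 'a) chart = "'m set \<times> ('m \<Rightarrow> 'a)"
type_synonym ('m, 'a) endo_field = "('m, 'a) chart \<Rightarrow> 'm \<Rightarrow> 'a \<Rightarrow> 'a"
type_synonym ('m, 'a) form_field = "('m, 'a) chart \<Rightarrow> 'm \<Rightarrow> 'a \<Rightarrow> real"
type_synonym ('m, 'a) bilin_field = "('m, 'a) chart \<Rightarrow> 'm \<Rightarrow> 'a \<Rightarrow> 'a \<Rightarrow> real"

definition chart_inv :: "('m, 'a) chart \<Rightarrow> 'a \<Rightarrow> 'm" where
  "chart_inv c = inv_into (fst c) (snd c)"

definition is_chart :: "('m::topological_space, 'a::euclidean_space) chart \<Rightarrow> bool" where
  "is_chart c \<longleftrightarrow> open (fst c) \<and> open (snd c ` fst c) \<and>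
     homeomorphism (fst c) (snd c ` fst c) (snd c) (chart_inv c)"

definition smooth_in ::
    "('m, 'a::euclidean_space) chart \<Rightarrow> 'm set \<Rightarrow> ('m \<Rightarrow> 'v::real_normed_vector) \<Rightarrow> bool" where
  "smooth_in c W F \<longleftrightarrow> smooth_on (snd c ` (fst c \<inter> W)) (F \<circ> chart_inv c)"

definition smooth_atlas :: "('m::topological_space, 'a::euclidean_space) chart set \<Rightarrow> bool" where
  "smooth_atlas A \<longleftrightarrow> (\<forall>c\<in>A. is_chart c) \<and> (\<Union>c\<in>A. fst c) = UNIV \<and>
     (\<forall>c\<in>A. \<forall>d\<in>A. smooth_in c (fst d) (snd d))"

text \<open>Derivative at \<open>p\<close> of a vector-valued function in the direction with components \<open>v\<close> in the chart \<open>c\<close>.\<close>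

definition coord_deriv ::
    "('m, 'a::euclidean_space) chart \<Rightarrow> ('m \<Rightarrow> 'v::real_normed_vector) \<Rightarrow> 'm \<Rightarrow> 'a \<Rightarrow> 'v" where
  "coord_deriv c F p v = frechet_derivative (F \<circ> chart_inv c) (at (snd c p)) v"

text \<open>Differential of \<open>f\<close> in the charts \<open>c\<close>, \<open>d\<close>; for \<open>f = id\<close> it is the change of components of
  tangent vectors from \<open>c\<close> to \<open>d\<close>.\<close>

definition differential :: "('m, 'a::euclidean_space) chart \<Rightarrow> ('k, 'b::euclidean_space) chart \<Rightarrow>
    ('m \<Rightarrow> 'k) \<Rightarrow> 'm \<Rightarrow> 'a \<Rightarrow> 'b" where
  "differential c d f p v = coord_deriv c (snd d \<circ> f) p v"

definition endo_field_on ::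
    "('m::topological_space, 'a::euclidean_space) chart set \<Rightarrow> 'm set \<Rightarrow> ('m, 'a) endo_field \<Rightarrow> bool" where
  "endo_field_on A W S \<longleftrightarrow>
     (\<forall>c\<in>A. \<forall>p\<in>fst c \<inter> W. linear (S c p)) \<and>
     (\<forall>c\<in>A. \<forall>v. smooth_in c W (\<lambda>p. S c p v)) \<and>
     (\<forall>c\<in>A. \<forall>d\<in>A. \<forall>p\<in>fst c \<inter> fst d \<inter> W. \<forall>v.
        S d p (differential c d id p v) = differential c d id p (S c p v))"

definition one_form_on ::
    "('m::topological_space, 'a::euclidean_space) chart set \<Rightarrow> 'm set \<Rightarrow> ('m, 'a) form_field \<Rightarrow> bool" where
  "one_form_on A W \<theta> \<longleftrightarrow>
     (\<forall>c\<in>A. \<forall>p\<in>fst c \<inter> W. linear (\<theta> c p)) \<and>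
     (\<forall>c\<in>A. \<forall>v. smooth_in c W (\<lambda>p. \<theta> c p v)) \<and>
     (\<forall>c\<in>A. \<forall>d\<in>A. \<forall>p\<in>fst c \<inter> fst d \<inter> W. \<forall>v. \<theta> d p (differential c d id p v) = \<theta> c p v)"


section \<open>Pseudo-Riemannian geometry\<close>

definition nondegenerate :: "('a::euclidean_space \<Rightarrow> 'a \<Rightarrow> real) \<Rightarrow> bool" where
  "nondegenerate b \<longleftrightarrow> (\<forall>u. (\<forall>v. b u v = 0) \<longrightarrow> u = 0)"

definition pseudo_riemannian ::
    "('m::topological_space, 'a::euclidean_space) chart set \<Rightarrow> ('m, 'a) bilin_field \<Rightarrow> bool" where
  "pseudo_riemannian A g \<longleftrightarrow>
     (\<forall>c\<in>A. \<forall>p\<in>fst c. bilinear (g c p) \<and> (\<forall>u v. g c p u v = g c p v u) \<and> nondegenerate (g c p)) \<and>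
     (\<forall>c\<in>A. \<forall>u v. smooth_in c UNIV (\<lambda>p. g c p u v)) \<and>
     (\<forall>c\<in>A. \<forall>d\<in>A. \<forall>p\<in>fst c \<inter> fst d. \<forall>u v.
        g d p (differential c d id p u) (differential c d id p v) = g c p u v)"

definition neutral_signature :: "('a::euclidean_space \<Rightarrow> 'a \<Rightarrow> real) \<Rightarrow> bool" where
  "neutral_signature b \<longleftrightarrow> (\<exists>P N. subspace P \<and> subspace N \<and> dim P = dim N \<and>
     dim P + dim N = DIM('a) \<and> (\<forall>u\<in>P - {0}. b u u > 0) \<and> (\<forall>u\<in>N - {0}. b u u < 0) \<and>
     (\<forall>u\<in>P. \<forall>v\<in>N. b u v = 0))"

text \<open>The Levi-Civita connection in the chart \<open>c\<close>: \<open>\<nabla>\<^sub>u Y = \<partial>\<^sub>u Y + \<Gamma>(u, Y)\<close>.  For such a connection,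
  torsion-freeness is symmetry of \<open>\<Gamma>\<close>, and the last clause is \<open>\<nabla>g = 0\<close> evaluated on
  coordinate-constant vector fields.\<close>

definition levi_civita :: "('m, 'a) bilin_field \<Rightarrow> ('m, 'a::euclidean_space) chart \<Rightarrow> 'm \<Rightarrow> 'a \<Rightarrow> 'a \<Rightarrow> 'a" where
  "levi_civita g c p = (THE \<Gamma>. bilinear \<Gamma> \<and> (\<forall>u v. \<Gamma> u v = \<Gamma> v u) \<and>
     (\<forall>u v w. coord_deriv c (\<lambda>q. g c q v w) p u = g c p (\<Gamma> u v) w + g c p v (\<Gamma> u w)))"

definition nabla_endo ::
    "('m, 'a) bilin_field \<Rightarrow> ('m, 'a::euclidean_space) chart \<Rightarrow> ('m, 'a) endo_field \<Rightarrow> 'm \<Rightarrow> 'a \<Rightarrow> 'a \<Rightarrow> 'a" where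
  "nabla_endo g c S p u v = coord_deriv c (\<lambda>q. S c q v) p u
     + levi_civita g c p u (S c p v) - S c p (levi_civita g c p u v)"

text \<open>\<open>R(u,v)w = \<nabla>\<^sub>u\<nabla>\<^sub>v w - \<nabla>\<^sub>v\<nabla>\<^sub>u w\<close> for coordinate-constant \<open>u, v, w\<close> (so that \<open>[u,v] = 0\<close>).\<close>

definition riemann ::
    "('m, 'a) bilin_field \<Rightarrow> ('m, 'a::euclidean_space) chart \<Rightarrow> 'm \<Rightarrow> 'a \<Rightarrow> 'a \<Rightarrow> 'a \<Rightarrow> 'a" where
  "riemann g c p u v w =
     coord_deriv c (\<lambda>q. levi_civita g c q v w) p u + levi_civita g c p u (levi_civita g c p v w)
     - coord_deriv c (\<lambda>q. levi_civita g c q u w) p v - levi_civita g c p v (levi_civita g c p u w)"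

definition endo_trace :: "('a::euclidean_space \<Rightarrow> 'a) \<Rightarrow> real" where
  "endo_trace T = (\<Sum>b\<in>Basis. T b \<bullet> b)"

definition ricci :: "('m, 'a) bilin_field \<Rightarrow> ('m, 'a::euclidean_space) chart \<Rightarrow> 'm \<Rightarrow> 'a \<Rightarrow> 'a \<Rightarrow> real" where
  "ricci g c p v w = endo_trace (\<lambda>u. riemann g c p u v w)"

definition scal :: "('m, 'a) bilin_field \<Rightarrow> ('m, 'a::euclidean_space) chart \<Rightarrow> 'm \<Rightarrow> real" where
  "scal g c p = endo_trace (THE T. linear T \<and> (\<forall>v w. g c p (T v) w = ricci g c p v w))"

definition reduced_scal ::
    "nat \<Rightarrow> ('m, 'a) bilin_field \<Rightarrow> ('m, 'a::euclidean_space) chart \<Rightarrow> 'm \<Rightarrow> real" where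
  "reduced_scal n g c p = scal g c p / (4 * real n * (real n + 2))"


section \<open>Para-quaternionic Kaehler manifolds\<close>

text \<open>Triples are indexed by \<open>{1, 2, 3}\<close>; values at other indices are irrelevant.\<close>

definition pq_signs :: "(nat \<Rightarrow> real) \<Rightarrow> bool" where
  "pq_signs e \<longleftrightarrow> (e 1, e 2, e 3) \<in> {(-1, 1, 1), (1, -1, 1), (1, 1, -1)}"

definition pq_basis :: "(nat \<Rightarrow> real) \<Rightarrow> (nat \<Rightarrow> 'a::euclidean_space \<Rightarrow> 'a) \<Rightarrow> bool" where
  "pq_basis e J \<longleftrightarrow> pq_signs e \<and>
     (\<forall>\<alpha>\<in>{1, 2, 3}. linear (J \<alpha>) \<and> (\<forall>v. J \<alpha> (J \<alpha> v) = e \<alpha> *\<^sub>R v)) \<and>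
     (\<forall>\<alpha>\<in>{1, 2, 3}. \<forall>\<beta>\<in>{1, 2, 3}. \<alpha> \<noteq> \<beta> \<longrightarrow> (\<forall>v. J \<alpha> (J \<beta> v) = - J \<beta> (J \<alpha> v))) \<and>
     (\<forall>v. J 3 v = J 1 (J 2 v))"

definition endo_span :: "(nat \<Rightarrow> 'a::euclidean_space \<Rightarrow> 'a) \<Rightarrow> ('a \<Rightarrow> 'a) set" where
  "endo_span J = {S. \<exists>a :: nat \<Rightarrow> real. S = (\<lambda>v. \<Sum>\<alpha>\<in>{1, 2, 3}. a \<alpha> *\<^sub>R J \<alpha> v)}"

type_synonym ('m, 'a) endo_subbundle = "('m, 'a) chart \<Rightarrow> 'm \<Rightarrow> ('a \<Rightarrow> 'a) set"

definition pq_frame_on :: "('m::topological_space, 'a::euclidean_space) chart set \<Rightarrow> 'm set \<Rightarrow>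
    ('m, 'a) endo_subbundle \<Rightarrow> (nat \<Rightarrow> real) \<Rightarrow> (nat \<Rightarrow> ('m, 'a) endo_field) \<Rightarrow> bool" where
  "pq_frame_on A W Q e J \<longleftrightarrow> open W \<and> (\<forall>\<alpha>\<in>{1, 2, 3}. endo_field_on A W (J \<alpha>)) \<and>
     (\<forall>c\<in>A. \<forall>p\<in>fst c \<inter> W. pq_basis e (\<lambda>\<alpha>. J \<alpha> c p) \<and> Q c p = endo_span (\<lambda>\<alpha>. J \<alpha> c p))"

definition almost_para_quaternionic ::
    "('m::topological_space, 'a::euclidean_space) chart set \<Rightarrow> ('m, 'a) endo_subbundle \<Rightarrow> bool" where
  "almost_para_quaternionic A Q \<longleftrightarrow> (\<forall>p. \<exists>W e J. p \<in> W \<and> pq_frame_on A W Q e J)"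

definition preserved_by_levi_civita :: "('m::topological_space, 'a::euclidean_space) chart set \<Rightarrow>
    ('m, 'a) endo_subbundle \<Rightarrow> ('m, 'a) bilin_field \<Rightarrow> bool" where
  "preserved_by_levi_civita A Q g \<longleftrightarrow>
     (\<forall>W S. open W \<and> endo_field_on A W S \<and> (\<forall>c\<in>A. \<forall>p\<in>fst c \<inter> W. S c p \<in> Q c p) \<longrightarrow>
        (\<forall>c\<in>A. \<forall>p\<in>fst c \<inter> W. \<forall>u. nabla_endo g c S p u \<in> Q c p))"

definition wedge_endo :: "('a::euclidean_space \<Rightarrow> 'a \<Rightarrow> real) \<Rightarrow> 'a \<Rightarrow> 'a \<Rightarrow> 'a \<Rightarrow> 'a" where
  "wedge_endo b x y z = b y z *\<^sub>R x - b x z *\<^sub>R y"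

definition curv_R0 :: "('a::euclidean_space \<Rightarrow> 'a \<Rightarrow> real) \<Rightarrow> (nat \<Rightarrow> real) \<Rightarrow> (nat \<Rightarrow> 'a \<Rightarrow> 'a) \<Rightarrow>
    'a \<Rightarrow> 'a \<Rightarrow> 'a \<Rightarrow> 'a" where
  "curv_R0 b e J x y z =
     (1/2) *\<^sub>R (\<Sum>\<alpha>\<in>{1, 2, 3}. (e \<alpha> * b (J \<alpha> x) y) *\<^sub>R J \<alpha> z) +
     (1/4) *\<^sub>R (wedge_endo b x y z - (\<Sum>\<alpha>\<in>{1, 2, 3}. e \<alpha> *\<^sub>R wedge_endo b (J \<alpha> x) (J \<alpha> y) z))"

definition algebraic_curvature_tensor ::
    "('a::euclidean_space \<Rightarrow> 'a \<Rightarrow> real) \<Rightarrow> ('a \<Rightarrow> 'a \<Rightarrow> 'a \<Rightarrow> 'a) \<Rightarrow> bool" where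
  "algebraic_curvature_tensor b W \<longleftrightarrow>
     (\<forall>y z. linear (\<lambda>x. W x y z)) \<and> (\<forall>x z. linear (\<lambda>y. W x y z)) \<and> (\<forall>x y. linear (W x y)) \<and>
     (\<forall>x y z. W x y z = - W y x z) \<and> (\<forall>x y z w. b (W x y z) w = - b z (W x y w)) \<and>
     (\<forall>x y z. W x y z + W y z x + W z x y = 0)"

text \<open>\<open>Q\<close>-invariance of \<open>W\<close> is \<open>[W(x,y), S] = 0\<close> for all \<open>S\<close> in \<open>Q\<close>.  \<open>R\<^sub>0\<close> does not depend on the
  basis \<open>J\<close> of \<open>Q\<close> used to write it.\<close>

definition dim4_curvature_condition :: "nat \<Rightarrow> ('m::topological_space, 'a::euclidean_space) chart set \<Rightarrow>
    ('m, 'a) endo_subbundle \<Rightarrow> ('m, 'a) bilin_field \<Rightarrow> bool" where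
  "dim4_curvature_condition n A Q g \<longleftrightarrow>
     (\<forall>c\<in>A. \<forall>p\<in>fst c. \<forall>e J. pq_basis e J \<and> Q c p = endo_span J \<longrightarrow>
       (\<exists>W. algebraic_curvature_tensor (g c p) W \<and>
            (\<forall>y z. endo_trace (\<lambda>x. W x y z) = 0) \<and>
            (\<forall>S\<in>Q c p. \<forall>x y z. W x y (S z) = S (W x y z)) \<and>
            (\<forall>x y z. riemann g c p x y z = reduced_scal n g c p *\<^sub>R curv_R0 (g c p) e J x y z + W x y z)))"

definition para_quaternionic_kaehler :: "nat \<Rightarrow> ('m::topological_space, 'a::euclidean_space) chart set \<Rightarrow>
    ('m, 'a) endo_subbundle \<Rightarrow> ('m, 'a) bilin_field \<Rightarrow> bool" where
  "para_quaternionic_kaehler n A Q g \<longleftrightarrow>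
     DIM('a) = 4 * n \<and> smooth_atlas A \<and> pseudo_riemannian A g \<and>
     (\<forall>c\<in>A. \<forall>p\<in>fst c. neutral_signature (g c p)) \<and>
     almost_para_quaternionic A Q \<and>
     (\<forall>c\<in>A. \<forall>p\<in>fst c. \<forall>S\<in>Q c p. \<forall>u v. g c p (S u) v = - g c p u (S v)) \<and>
     preserved_by_levi_civita A Q g \<and>
     (n = 1 \<longrightarrow> dim4_curvature_condition n A Q g)"


section \<open>Submanifolds\<close>

text \<open>A submanifold is an injective immersion \<open>f\<close> of a manifold with atlas \<open>A\<close> into a manifold with
  atlas \<open>B\<close>; in charts \<open>c \<in> A\<close>, \<open>d \<in> B\<close> its tangent space at \<open>p\<close> is \<open>range (differential c d f p)\<close>.\<close>

definition immersed_submanifold :: "('m::topological_space, 'a::euclidean_space) chart set \<Rightarrow>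
    ('k::topological_space, 'b::euclidean_space) chart set \<Rightarrow> ('m \<Rightarrow> 'k) \<Rightarrow> bool" where
  "immersed_submanifold A B f \<longleftrightarrow> smooth_atlas A \<and> inj f \<and> continuous_on UNIV f \<and>
     (\<forall>c\<in>A. \<forall>d\<in>B. smooth_in c (f -` fst d) (snd d \<circ> f) \<and>
        (\<forall>p\<in>fst c \<inter> f -` fst d. inj (differential c d f p)))"

definition induced_metric :: "('m::topological_space, 'a::euclidean_space) chart set \<Rightarrow>
    ('k::topological_space, 'b::euclidean_space) chart set \<Rightarrow> ('m \<Rightarrow> 'k) \<Rightarrow>
    ('k, 'b) bilin_field \<Rightarrow> ('m, 'a) bilin_field \<Rightarrow> bool" where
  "induced_metric A B f gt g \<longleftrightarrow>
     (\<forall>c\<in>A. \<forall>d\<in>B. \<forall>p\<in>fst c \<inter> f -` fst d. \<forall>u v.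
        g c p u v = gt d (f p) (differential c d f p u) (differential c d f p v))"

text \<open>\<open>Je d p\<close> is the value at the point \<open>p\<close> of the submanifold, in the chart \<open>d\<close> of the ambient
  manifold, of the section of \<open>Q\<close> along the submanifold; \<open>JT\<close> is its restriction to the tangent bundle.\<close>

definition almost_eps_hermitian_submanifold :: "real \<Rightarrow>
    ('m::topological_space, 'a::euclidean_space) chart set \<Rightarrow>
    ('k::topological_space, 'b::euclidean_space) chart set \<Rightarrow> ('m \<Rightarrow> 'k) \<Rightarrow>
    ('k, 'b) endo_subbundle \<Rightarrow> ('k, 'b) bilin_field \<Rightarrow> ('m, 'a) bilin_field \<Rightarrow>
    (('k, 'b) chart \<Rightarrow> 'm \<Rightarrow> 'b \<Rightarrow> 'b) \<Rightarrow> ('m, 'a) endo_field \<Rightarrow> bool" where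
  "almost_eps_hermitian_submanifold \<epsilon> A B f Q gt g Je JT \<longleftrightarrow>
     immersed_submanifold A B f \<and> induced_metric A B f gt g \<and> pseudo_riemannian A g \<and>
     (\<forall>c\<in>A. \<forall>d\<in>B. \<forall>w. smooth_in c (f -` fst d) (\<lambda>p. Je d p w)) \<and>
     (\<forall>d\<in>B. \<forall>d'\<in>B. \<forall>p\<in>f -` (fst d \<inter> fst d'). \<forall>w.
        Je d' p (differential d d' id (f p) w) = differential d d' id (f p) (Je d p w)) \<and>
     (\<forall>d\<in>B. \<forall>p\<in>f -` fst d. Je d p \<in> Q d (f p) \<and> (\<forall>w. Je d p (Je d p w) = \<epsilon> *\<^sub>R w)) \<and>
     (\<forall>c\<in>A. \<forall>d\<in>B. \<forall>p\<in>fst c \<inter> f -` fst d.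
        Je d p ` range (differential c d f p) = range (differential c d f p)) \<and>
     endo_field_on A UNIV JT \<and>
     (\<forall>c\<in>A. \<forall>d\<in>B. \<forall>p\<in>fst c \<inter> f -` fst d. \<forall>u.
        differential c d f p (JT c p u) = Je d p (differential c d f p u))"

text \<open>\<open>\<nabla>F = 0\<close> for \<open>F(X,Y) = g(\<J>X, Y)\<close>.\<close>

definition fundamental_form_parallel :: "('m::topological_space, 'a::euclidean_space) chart set \<Rightarrow>
    ('m, 'a) bilin_field \<Rightarrow> ('m, 'a) endo_field \<Rightarrow> bool" where
  "fundamental_form_parallel A g JT \<longleftrightarrow>
     (\<forall>c\<in>A. \<forall>p\<in>fst c. \<forall>w u v.
        coord_deriv c (\<lambda>q. g c q (JT c q u) v) p w
        - g c p (JT c p (levi_civita g c p w u)) v - g c p (JT c p u) (levi_civita g c p w v) = 0)"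

definition eps_kaehler_submanifold :: "real \<Rightarrow>
    ('m::topological_space, 'a::euclidean_space) chart set \<Rightarrow>
    ('k::topological_space, 'b::euclidean_space) chart set \<Rightarrow> ('m \<Rightarrow> 'k) \<Rightarrow>
    ('k, 'b) endo_subbundle \<Rightarrow> ('k, 'b) bilin_field \<Rightarrow> ('m, 'a) bilin_field \<Rightarrow>
    (('k, 'b) chart \<Rightarrow> 'm \<Rightarrow> 'b \<Rightarrow> 'b) \<Rightarrow> ('m, 'a) endo_field \<Rightarrow> bool" where
  "eps_kaehler_submanifold \<epsilon> A B f Q gt g Je JT \<longleftrightarrow>
     almost_eps_hermitian_submanifold \<epsilon> A B f Q gt g Je JT \<and> fundamental_form_parallel A g JT"

definition adapted_signs :: "real \<Rightarrow> nat \<Rightarrow> real" where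
  "adapted_signs \<epsilon> \<alpha> = (if \<alpha> = 1 then \<epsilon> else if \<alpha> = 2 then 1 else - \<epsilon>)"

definition adapted_basis :: "real \<Rightarrow> ('k::topological_space, 'b::euclidean_space) chart set \<Rightarrow> 'k set \<Rightarrow>
    ('m \<Rightarrow> 'k) \<Rightarrow> ('k, 'b) endo_subbundle \<Rightarrow> (('k, 'b) chart \<Rightarrow> 'm \<Rightarrow> 'b \<Rightarrow> 'b) \<Rightarrow>
    (nat \<Rightarrow> ('k, 'b) endo_field) \<Rightarrow> bool" where
  "adapted_basis \<epsilon> B N f Q Je J \<longleftrightarrow> pq_frame_on B N Q (adapted_signs \<epsilon>) J \<and>
     (\<forall>d\<in>B. \<forall>p\<in>f -` (fst d \<inter> N). J 1 d (f p) = Je d p)"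

definition connection_forms :: "('k::topological_space, 'b::euclidean_space) chart set \<Rightarrow> 'k set \<Rightarrow>
    ('k, 'b) bilin_field \<Rightarrow> (nat \<Rightarrow> real) \<Rightarrow> (nat \<Rightarrow> ('k, 'b) endo_field) \<Rightarrow>
    (nat \<Rightarrow> ('k, 'b) form_field) \<Rightarrow> bool" where
  "connection_forms B N g e J \<omega> \<longleftrightarrow> (\<forall>\<alpha>\<in>{1, 2, 3}. one_form_on B N (\<omega> \<alpha>)) \<and>
     (\<forall>(\<alpha>, \<beta>, \<gamma>)\<in>{(1, 2, 3), (2, 3, 1), (3, 1, 2)}. \<forall>d\<in>B. \<forall>q\<in>fst d \<inter> N. \<forall>u v.
        nabla_endo g d (J \<alpha>) q u v =
          - (e \<beta> * \<omega> \<gamma> d q u) *\<^sub>R J \<beta> d q v + (e \<gamma> * \<omega> \<beta> d q u) *\<^sub>R J \<gamma> d q v)"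

definition totally_complex :: "('m::topological_space, 'a::euclidean_space) chart set \<Rightarrow>
    ('k::topological_space, 'b::euclidean_space) chart set \<Rightarrow> 'k set \<Rightarrow> ('m \<Rightarrow> 'k) \<Rightarrow>
    ('k, 'b) bilin_field \<Rightarrow> (nat \<Rightarrow> ('k, 'b) endo_field) \<Rightarrow> bool" where
  "totally_complex A B N f gt J \<longleftrightarrow>
     (\<forall>c\<in>A. \<forall>d\<in>B. \<forall>p\<in>fst c \<inter> f -` (fst d \<inter> N). \<forall>u v.
        gt d (f p) (J 2 d (f p) (differential c d f p u)) (differential c d f p v) = 0)"

text \<open>Covariant derivative, for the ambient Levi-Civita connection, in the tangent direction \<open>u\<close> of a
  vector field \<open>Z\<close> along \<open>f\<close> given by its components in the ambient chart \<open>d\<close>.\<close>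

definition nabla_along :: "('m, 'a::euclidean_space) chart \<Rightarrow> ('k, 'b::euclidean_space) chart \<Rightarrow>
    ('m \<Rightarrow> 'k) \<Rightarrow> ('k, 'b) bilin_field \<Rightarrow> ('m \<Rightarrow> 'b) \<Rightarrow> 'm \<Rightarrow> 'a \<Rightarrow> 'b" where
  "nabla_along c d f gt Z p u =
     coord_deriv c Z p u + levi_civita gt d (f p) (differential c d f p u) (Z p)"

text \<open>The ambient covariant derivative of the section \<open>Je\<close> in tangent directions vanishes; in terms of
  an adapted basis, \<open>\<omega>\<^sub>2 = \<omega>\<^sub>3 = 0\<close> on the tangent bundle of the submanifold.  For surfaces (\<open>n = 1\<close>) this does
  not follow from the other conditions, which every non-degenerate oriented surface satisfies.\<close>

definition parallel_along :: "('m::topological_space, 'a::euclidean_space) chart set \<Rightarrow>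
    ('k::topological_space, 'b::euclidean_space) chart set \<Rightarrow> ('m \<Rightarrow> 'k) \<Rightarrow> ('k, 'b) bilin_field \<Rightarrow>
    (('k, 'b) chart \<Rightarrow> 'm \<Rightarrow> 'b \<Rightarrow> 'b) \<Rightarrow> bool" where
  "parallel_along A B f gt Je \<longleftrightarrow>
     (\<forall>c\<in>A. \<forall>d\<in>B. \<forall>p\<in>fst c \<inter> f -` fst d. \<forall>u w.
        nabla_along c d f gt (\<lambda>q. Je d q w) p u
          = Je d p (levi_civita gt d (f p) (differential c d f p u) w))"

definition tangential_part :: "('m, 'a::euclidean_space) chart \<Rightarrow> ('k, 'b::euclidean_space) chart \<Rightarrow>
    ('m \<Rightarrow> 'k) \<Rightarrow> ('k, 'b) bilin_field \<Rightarrow> 'm \<Rightarrow> 'b \<Rightarrow> 'b" where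
  "tangential_part c d f gt p w = (THE t. t \<in> range (differential c d f p) \<and>
     (\<forall>u. gt d (f p) (w - t) (differential c d f p u) = 0))"

definition normal_part :: "('m, 'a::euclidean_space) chart \<Rightarrow> ('k, 'b::euclidean_space) chart \<Rightarrow>
    ('m \<Rightarrow> 'k) \<Rightarrow> ('k, 'b) bilin_field \<Rightarrow> 'm \<Rightarrow> 'b \<Rightarrow> 'b" where
  "normal_part c d f gt p w = w - tangential_part c d f gt p w"

text \<open>In the definitions below the arguments \<open>u, v, w\<close> are extended to coordinate-constant fields in
  the chart \<open>c\<close>; the resulting expressions are tensorial.\<close>

definition second_fundamental_form :: "('m, 'a::euclidean_space) chart \<Rightarrow>
    ('k, 'b::euclidean_space) chart \<Rightarrow> ('m \<Rightarrow> 'k) \<Rightarrow> ('k, 'b) bilin_field \<Rightarrow> 'm \<Rightarrow> 'a \<Rightarrow> 'a \<Rightarrow> 'b" where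
  "second_fundamental_form c d f gt p u v =
     normal_part c d f gt p (nabla_along c d f gt (\<lambda>q. differential c d f q v) p u)"

definition normal_connection :: "('m, 'a::euclidean_space) chart \<Rightarrow>
    ('k, 'b::euclidean_space) chart \<Rightarrow> ('m \<Rightarrow> 'k) \<Rightarrow> ('k, 'b) bilin_field \<Rightarrow> ('m \<Rightarrow> 'b) \<Rightarrow> 'm \<Rightarrow> 'a \<Rightarrow> 'b" where
  "normal_connection c d f gt \<xi> p u = normal_part c d f gt p (nabla_along c d f gt \<xi> p u)"

definition nabla_h :: "('m, 'a::euclidean_space) chart \<Rightarrow> ('k, 'b::euclidean_space) chart \<Rightarrow>
    ('m \<Rightarrow> 'k) \<Rightarrow> ('k, 'b) bilin_field \<Rightarrow> ('m, 'a) bilin_field \<Rightarrow> 'm \<Rightarrow> 'a \<Rightarrow> 'a \<Rightarrow> 'a \<Rightarrow> 'b" where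
  "nabla_h c d f gt g p u v w =
     normal_connection c d f gt (\<lambda>q. second_fundamental_form c d f gt q v w) p u
     - second_fundamental_form c d f gt p (levi_civita g c p u v) w
     - second_fundamental_form c d f gt p v (levi_civita g c p u w)"

text \<open>The shape tensor as a tensor on the submanifold: \<open>shape_tensor \<dots> p u v\<close> is the vector of the
  tangent space of the submanifold mapped by the differential of \<open>f\<close> to \<open>J\<^sub>2 h(u,v)\<close>.\<close>

definition shape_tensor :: "('m, 'a::euclidean_space) chart \<Rightarrow> ('k, 'b::euclidean_space) chart \<Rightarrow>
    ('m \<Rightarrow> 'k) \<Rightarrow> ('k, 'b) bilin_field \<Rightarrow> (nat \<Rightarrow> ('k, 'b) endo_field) \<Rightarrow> 'm \<Rightarrow> 'a \<Rightarrow> 'a \<Rightarrow> 'a" where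
  "shape_tensor c d f gt J p u v =
     (THE t. differential c d f p t = J 2 d (f p) (second_fundamental_form c d f gt p u v))"

definition nabla_shape :: "('m, 'a::euclidean_space) chart \<Rightarrow> ('k, 'b::euclidean_space) chart \<Rightarrow>
    ('m \<Rightarrow> 'k) \<Rightarrow> ('k, 'b) bilin_field \<Rightarrow> ('m, 'a) bilin_field \<Rightarrow> (nat \<Rightarrow> ('k, 'b) endo_field) \<Rightarrow>
    'm \<Rightarrow> 'a \<Rightarrow> 'a \<Rightarrow> 'a \<Rightarrow> 'a" where
  "nabla_shape c d f gt g J p u v w =
     coord_deriv c (\<lambda>q. shape_tensor c d f gt J q v w) p u
     + levi_civita g c p u (shape_tensor c d f gt J p v w)
     - shape_tensor c d f gt J p (levi_civita g c p u v) w
     - shape_tensor c d f gt J p v (levi_civita g c p u w)"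

definition S_space :: "('a::euclidean_space \<Rightarrow> 'a \<Rightarrow> real) \<Rightarrow> ('a \<Rightarrow> 'a) \<Rightarrow> ('a \<Rightarrow> 'a) set" where
  "S_space b K = {T. linear T \<and> (\<forall>x. T (K x) + K (T x) = 0) \<and> (\<forall>x y. b (T x) y = b x (T y))}"

definition S_prolongation ::
    "('a::euclidean_space \<Rightarrow> 'a \<Rightarrow> real) \<Rightarrow> ('a \<Rightarrow> 'a) \<Rightarrow> ('a \<Rightarrow> 'a \<Rightarrow> 'a) set" where
  "S_prolongation b K =
     {T. (\<forall>x. T x \<in> S_space b K) \<and> (\<forall>y. linear (\<lambda>x. T x y)) \<and> (\<forall>x y. T x y = T y x)}"

end

theory Submission
  imports Defs
begin

text \<open>Everything comes from differentiating, in a tangent direction \<open>X\<close> and with the ambient connection,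
  three identities that hold along the submanifold.  Write \<open>D\<close> for the ambient connection, \<open>h\<close> for the second
  fundamental form, \<open>F(X, Y) = g(\<J>X, Y)\<close>, and recall that
  \<open>D J\<^sub>1 = - \<omega>\<^sub>3 J\<^sub>2 - \<epsilon> \<omega>\<^sub>2 J\<^sub>3\<close>, \<open>D J\<^sub>2 = \<epsilon> \<omega>\<^sub>1 J\<^sub>3 + \<epsilon> \<omega>\<^sub>3 J\<^sub>1\<close> and
  \<open>D J\<^sub>3 = - \<epsilon> \<omega>\<^sub>2 J\<^sub>1 + \<omega>\<^sub>1 J\<^sub>2\<close>.  The tool that evaluates the derivatives is the Gauss formula
  \<open>D\<^sub>X Y = \<nabla>\<^sub>X Y + h(X, Y)\<close> (\<open>gauss_formula\<close>).

  First identity: \<open>J\<^sub>2 Y\<close> and \<open>J\<^sub>3 Y = J\<^sub>1 J\<^sub>2 Y\<close> are orthogonal to \<open>Z\<close> for tangent \<open>Y, Z\<close>.  For \<open>a = 2, 3\<close>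
  put \<open>T(X, Y, Z) = g(J\<^sub>a D\<^sub>X Y, Z)\<close>, which is symmetric in \<open>X, Y\<close> for coordinate
  fields because \<open>D\<close> is torsion-free.  Differentiating \<open>g(J\<^sub>a Y, Z) = 0\<close> gives \<open>\<theta>(X) F(Y, Z) = T(X, Z, Y) - T(X, Y, Z)\<close>, where
  \<open>\<theta>\<close> is \<open>\<epsilon> \<omega>\<^sub>3\<close> for \<open>a = 2\<close> and \<open>- \<epsilon> \<omega>\<^sub>2\<close> for \<open>a = 3\<close>
  (\<open>derivative_of_normality\<close>).  By the symmetry of \<open>T\<close> the cyclic sum of the right-hand side is zero; thus
  \<open>\<theta> \<and> F = 0\<close>, and since \<open>F\<close> is non-degenerate this forces \<open>\<theta> = 0\<close> as soon as the submanifold has dimension at least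
  three (\<open>one_form_vanishes\<close>).  For surfaces the vanishing of \<open>\<omega>\<^sub>2\<close> and \<open>\<omega>\<^sub>3\<close> on tangent vectors is the
  hypothesis that the section of \<open>Q\<close> is parallel (\<open>forms_vanish\<close> covers both cases).  With \<open>\<theta> = 0\<close>,
  the case \<open>a = 2\<close> says that \<open>C\<^sub>X = J\<^sub>2 h(X, \<cdot>)\<close> is self-adjoint.

  Second identity: \<open>\<J>Y = J\<^sub>1 Y\<close>.  As \<open>D\<^sub>X J\<^sub>1 = 0\<close>, the normal part of its derivative is
  \<open>h(X, \<J>Y) = J\<^sub>1 h(X, Y)\<close> (\<open>sff_JT\<close>), so \<open>C\<^sub>X\<close> anticommutes with \<open>\<J>\<close>, because \<open>J\<^sub>1\<close> and \<open>J\<^sub>2\<close> do.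
  Together with the symmetry of \<open>h\<close> this puts \<open>C\<close> into the prolongation.

  Third identity: \<open>C\<^sub>Y Z = J\<^sub>2 h(Y, Z)\<close>.  Now \<open>D\<^sub>X J\<^sub>2 = \<epsilon> \<omega>(X) J\<^sub>1 J\<^sub>2\<close>, which contributes the term
  \<open>\<epsilon> \<omega>(X) \<J>(C\<^sub>Y Z)\<close>; as \<open>J\<^sub>2\<close> exchanges tangent and normal vectors, the tangential part of the rest is
  \<open>J\<^sub>2\<close> of the normal derivative of \<open>h\<close> (\<open>nabla_shape_formula\<close>).

  The Christoffel symbols and the shape tensor are characterised by equations and not given by formulas, so their
  differentiability is part of the work.  Both solve linear systems whose matrix is the metric, and
  \<open>differentiable_nondegenerate_solution\<close> applies.\<close>

section \<open>Calculus in a Euclidean space\<close>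

text \<open>The product rule for a family of linear maps applied to a moving vector.  Differentiability of the family is
  only required on each fixed vector, which is the form in which components of tensor fields are smooth.\<close>

lemma has_derivative_linear_family:
  fixes L :: "'x::real_normed_vector \<Rightarrow> 'e::euclidean_space \<Rightarrow> 'v::real_normed_vector"
  assumes S: "open S" "x \<in> S" and lin: "\<And>y. y \<in> S \<Longrightarrow> linear (L y)"
    and diff: "\<And>e. (\<lambda>y. L y e) differentiable (at x)" and a: "(a has_derivative a') (at x)"
  shows "((\<lambda>y. L y (a y)) has_derivative
    (\<lambda>h. frechet_derivative (\<lambda>y. L y (a x)) (at x) h + L x (a' h))) (at x)"
proof -
  define D where "D = (\<lambda>e. frechet_derivative (\<lambda>y. L y e) (at x))"
  have D: "((\<lambda>y. L y e) has_derivative D e) (at x)" for e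
    using diff frechet_derivative_works unfolding D_def by blast
  have expand: "(\<Sum>b\<in>Basis. (v \<bullet> b) *\<^sub>R L y b) = L y v" if "y \<in> S" for y v
  proof -
    have "L y v = L y (\<Sum>b\<in>Basis. (v \<bullet> b) *\<^sub>R b)"
      by (simp add: euclidean_representation)
    also have "\<dots> = (\<Sum>b\<in>Basis. (v \<bullet> b) *\<^sub>R L y b)"
      using lin[OF that] by (simp add: linear_sum linear_scale)
    finally show ?thesis by simp
  qed
  have "((\<lambda>y. \<Sum>b\<in>Basis. (a y \<bullet> b) *\<^sub>R L y b) has_derivative
      (\<lambda>h. \<Sum>b\<in>Basis. (a x \<bullet> b) *\<^sub>R D b h + (a' h \<bullet> b) *\<^sub>R L x b)) (at x)"
    by (intro has_derivative_sum has_derivative_scaleR has_derivative_inner_left a D)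
  then have main: "((\<lambda>y. L y (a y)) has_derivative
      (\<lambda>h. \<Sum>b\<in>Basis. (a x \<bullet> b) *\<^sub>R D b h + (a' h \<bullet> b) *\<^sub>R L x b)) (at x)"
    by (rule has_derivative_transform_within_open[OF _ S]) (simp add: expand)
  have "((\<lambda>y. \<Sum>b\<in>Basis. (a x \<bullet> b) *\<^sub>R L y b) has_derivative
      (\<lambda>h. \<Sum>b\<in>Basis. (a x \<bullet> b) *\<^sub>R D b h)) (at x)"
    by (intro has_derivative_sum has_derivative_scaleR_right D)
  then have "((\<lambda>y. L y (a x)) has_derivative (\<lambda>h. \<Sum>b\<in>Basis. (a x \<bullet> b) *\<^sub>R D b h)) (at x)"
    by (rule has_derivative_transform_within_open[OF _ S]) (simp add: expand)
  then have "frechet_derivative (\<lambda>y. L y (a x)) (at x) = (\<lambda>h. \<Sum>b\<in>Basis. (a x \<bullet> b) *\<^sub>R D b h)"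
    using frechet_derivative_at by fastforce
  with main show ?thesis
    by (simp add: sum.distrib expand[OF S(2)])
qed

lemma Ck_on_subset: "Ck_on k S F \<Longrightarrow> T \<subseteq> S \<Longrightarrow> Ck_on k T F"
proof (induction k arbitrary: F)
  case 0
  then show ?case by (auto intro: continuous_on_subset)
next
  case (Suc k)
  then show ?case by auto
qed

lemma directional_mean_value:
  fixes F :: "'a::real_normed_vector \<Rightarrow> real"
  assumes "t > 0" and diff: "\<And>s. s \<in> {0..t} \<Longrightarrow> F differentiable (at (y + s *\<^sub>R u))"
  shows "\<exists>\<xi>\<in>{0<..<t}. F (y + t *\<^sub>R u) - F y = t * frechet_derivative F (at (y + \<xi> *\<^sub>R u)) u"
proof -
  let ?D = "\<lambda>s. frechet_derivative F (at (y + s *\<^sub>R u))"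
  have der: "((\<lambda>s. F (y + s *\<^sub>R u)) has_derivative (\<lambda>h. ?D s (h *\<^sub>R u))) (at s within {0..t})"
    if "s \<in> {0..t}" for s
  proof -
    have 1: "((\<lambda>s. y + s *\<^sub>R u) has_derivative (\<lambda>h. h *\<^sub>R u)) (at s within {0..t})"
      by (auto intro!: derivative_eq_intros)
    have 2: "(F has_derivative ?D s) (at (y + s *\<^sub>R u))"
      using diff[OF that] frechet_derivative_works by blast
    show ?thesis using has_derivative_compose[OF 1 2] .
  qed
  obtain \<xi> where \<xi>: "\<xi> \<in> {0<..<t}"
    and eq: "F (y + t *\<^sub>R u) - F (y + 0 *\<^sub>R u) = ?D \<xi> ((t - 0) *\<^sub>R u)"
    using mvt_simple[OF \<open>t > 0\<close>, of "\<lambda>s. F (y + s *\<^sub>R u)" "\<lambda>s h. ?D s (h *\<^sub>R u)"] der by fastforce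
  have "linear (?D \<xi>)"
    using diff[of \<xi>] \<xi> by (intro linear_frechet_derivative) auto
  then show ?thesis using \<xi> eq by (auto simp: linear_scale)
qed

text \<open>Two mean value steps turn the second difference over a parallelogram with sides \<open>t u\<close> and \<open>t v\<close> into a mixed second
  derivative at an intermediate point.  The second difference is symmetric in \<open>u\<close> and \<open>v\<close>, which is why mixed
  derivatives commute.\<close>

lemma second_difference_mean_value:
  fixes F :: "'a::real_normed_vector \<Rightarrow> real"
  assumes "t > 0"
    and ball: "\<And>r s. r \<in> {0..t} \<Longrightarrow> s \<in> {0..t} \<Longrightarrow> x + r *\<^sub>R u + s *\<^sub>R v \<in> S"
    and diff: "\<And>y. y \<in> S \<Longrightarrow> F differentiable (at y)"
    and diff2: "\<And>y. y \<in> S \<Longrightarrow> (\<lambda>z. frechet_derivative F (at z) u) differentiable (at y)"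
  shows "\<exists>r\<in>{0..t}. \<exists>s\<in>{0..t}. F (x + t *\<^sub>R u + t *\<^sub>R v) - F (x + t *\<^sub>R u) - F (x + t *\<^sub>R v) + F x
      = t * t * frechet_derivative (\<lambda>z. frechet_derivative F (at z) u) (at (x + r *\<^sub>R u + s *\<^sub>R v)) v"
proof -
  define H where "H = (\<lambda>z. F (z + t *\<^sub>R v) - F z)"
  have dF: "F differentiable (at (x + r *\<^sub>R u))" "F differentiable (at (x + r *\<^sub>R u + t *\<^sub>R v))"
    if "r \<in> {0..t}" for r
    using diff ball[OF that, of 0] ball[OF that, of t] \<open>t > 0\<close> by auto
  have H: "(H has_derivative (\<lambda>h. frechet_derivative F (at (x + r *\<^sub>R u + t *\<^sub>R v)) h
      - frechet_derivative F (at (x + r *\<^sub>R u)) h)) (at (x + r *\<^sub>R u))" if "r \<in> {0..t}" for r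
  proof -
    have 1: "((\<lambda>z. z + t *\<^sub>R v) has_derivative (\<lambda>h. h)) (at (x + r *\<^sub>R u))"
      by (auto intro!: derivative_eq_intros)
    have 2: "(F has_derivative frechet_derivative F (at (x + r *\<^sub>R u + t *\<^sub>R v))) (at (x + r *\<^sub>R u + t *\<^sub>R v))"
      using dF(2)[OF that] frechet_derivative_works by blast
    have 3: "(F has_derivative frechet_derivative F (at (x + r *\<^sub>R u))) (at (x + r *\<^sub>R u))"
      using dF(1)[OF that] frechet_derivative_works by blast
    show ?thesis unfolding H_def
      using has_derivative_diff[OF has_derivative_compose[OF 1 2] 3] .
  qed
  obtain r where r: "r \<in> {0<..<t}"
    and Hr: "H (x + t *\<^sub>R u) - H x = t * frechet_derivative H (at (x + r *\<^sub>R u)) u"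
    using directional_mean_value[OF \<open>t > 0\<close> differentiableI[OF H]] by blast
  have "r \<in> {0..t}" using r by auto
  have Hr': "frechet_derivative H (at (x + r *\<^sub>R u)) u = frechet_derivative F (at (x + r *\<^sub>R u + t *\<^sub>R v)) u
      - frechet_derivative F (at (x + r *\<^sub>R u)) u"
    unfolding frechet_derivative_at[OF H[OF \<open>r \<in> {0..t}\<close>], symmetric] ..
  obtain s where s: "s \<in> {0<..<t}"
    and "frechet_derivative F (at (x + r *\<^sub>R u + t *\<^sub>R v)) u - frechet_derivative F (at (x + r *\<^sub>R u)) u
      = t * frechet_derivative (\<lambda>z. frechet_derivative F (at z) u) (at (x + r *\<^sub>R u + s *\<^sub>R v)) v"
    using directional_mean_value[OF \<open>t > 0\<close> diff2[OF ball[OF \<open>r \<in> {0..t}\<close>]]] by blast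
  with Hr Hr' have "H (x + t *\<^sub>R u) - H x
      = t * t * frechet_derivative (\<lambda>z. frechet_derivative F (at z) u) (at (x + r *\<^sub>R u + s *\<^sub>R v)) v"
    by simp
  then have "F (x + t *\<^sub>R u + t *\<^sub>R v) - F (x + t *\<^sub>R u) - F (x + t *\<^sub>R v) + F x
      = t * t * frechet_derivative (\<lambda>z. frechet_derivative F (at z) u) (at (x + r *\<^sub>R u + s *\<^sub>R v)) v"
    unfolding H_def by linarith
  moreover have "s \<in> {0..t}" using s by auto
  ultimately show ?thesis using \<open>r \<in> {0..t}\<close> by blast
qed

lemma symmetric_second_derivative_real:
  fixes F :: "'a::euclidean_space \<Rightarrow> real"
  assumes S: "open S" "x \<in> S" and F: "Ck_on (Suc (Suc 0)) S F"
  shows "frechet_derivative (\<lambda>z. frechet_derivative F (at z) u) (at x) v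
       = frechet_derivative (\<lambda>z. frechet_derivative F (at z) v) (at x) u"
proof -
  let ?P = "\<lambda>y. frechet_derivative (\<lambda>z. frechet_derivative F (at z) u) (at y) v"
  let ?Q = "\<lambda>y. frechet_derivative (\<lambda>z. frechet_derivative F (at z) v) (at y) u"
  have diff: "F differentiable (at y)" "(\<lambda>z. frechet_derivative F (at z) w) differentiable (at y)"
    if "y \<in> S" for y w using F that by auto
  have "continuous_on S ?P" "continuous_on S ?Q" using F by auto
  then have cont: "isCont ?P x" "isCont ?Q x" using S by (simp_all add: continuous_on_eq_continuous_at)
  have "dist (?P x) (?Q x) < e" if "e > 0" for e
  proof -
    obtain d1 where d1: "d1 > 0" "\<And>y. dist y x < d1 \<Longrightarrow> dist (?P y) (?P x) < e / 2"
      using cont(1)[unfolded continuous_at_eps_delta, rule_format, OF half_gt_zero[OF \<open>e > 0\<close>]] by blast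
    obtain d2 where d2: "d2 > 0" "\<And>y. dist y x < d2 \<Longrightarrow> dist (?Q y) (?Q x) < e / 2"
      using cont(2)[unfolded continuous_at_eps_delta, rule_format, OF half_gt_zero[OF \<open>e > 0\<close>]] by blast
    obtain d3 where d3: "d3 > 0" "ball x d3 \<subseteq> S" using S open_contains_ball by blast
    \<comment> \<open>Points of the parallelogram with sides \<open>t u\<close> and \<open>t v\<close> stay within \<open>m\<close> of \<open>x\<close>.\<close>
    define m where "m = min d1 (min d2 d3)"
    define t where "t = m / (2 * (norm u + norm v + 1))"
    have "m > 0" using d1 d2 d3 by (simp add: m_def)
    have den: "norm u + norm v + 1 > 0" by (smt (verit) norm_ge_zero)
    have "t > 0" using \<open>m > 0\<close> den by (simp add: t_def)
    have near: "dist (x + r *\<^sub>R u + s *\<^sub>R v) x < m" if "r \<in> {0..t}" "s \<in> {0..t}" for r s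
    proof -
      have "dist (x + r *\<^sub>R u + s *\<^sub>R v) x = norm (r *\<^sub>R u + s *\<^sub>R v)" by (simp add: dist_norm)
      also have "\<dots> \<le> r * norm u + s * norm v"
        using norm_triangle_ineq[of "r *\<^sub>R u" "s *\<^sub>R v"] that by simp
      also have "\<dots> \<le> t * norm u + t * norm v"
        using that by (intro add_mono mult_right_mono) auto
      also have "\<dots> \<le> t * (norm u + norm v + 1)" using \<open>t > 0\<close> by (simp add: algebra_simps)
      also have "\<dots> = m / 2" using den by (simp add: t_def field_simps)
      finally show ?thesis using \<open>m > 0\<close> by simp
    qed
    have inS: "x + r *\<^sub>R u + s *\<^sub>R v \<in> S" if "r \<in> {0..t}" "s \<in> {0..t}" for r s
      using near[OF that] d3 unfolding m_def by (auto simp: dist_commute)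
    have inS': "x + r *\<^sub>R v + s *\<^sub>R u \<in> S" if "r \<in> {0..t}" "s \<in> {0..t}" for r s
      using inS[OF that(2,1)] by (simp add: algebra_simps)
    obtain r s where rs: "r \<in> {0..t}" "s \<in> {0..t}"
      "F (x + t *\<^sub>R u + t *\<^sub>R v) - F (x + t *\<^sub>R u) - F (x + t *\<^sub>R v) + F x
        = t * t * ?P (x + r *\<^sub>R u + s *\<^sub>R v)"
      using second_difference_mean_value[OF \<open>t > 0\<close> inS diff(1) diff(2)] by blast
    obtain r' s' where rs': "r' \<in> {0..t}" "s' \<in> {0..t}"
      "F (x + t *\<^sub>R v + t *\<^sub>R u) - F (x + t *\<^sub>R v) - F (x + t *\<^sub>R u) + F x
        = t * t * ?Q (x + r' *\<^sub>R v + s' *\<^sub>R u)"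
      using second_difference_mean_value[OF \<open>t > 0\<close> inS' diff(1) diff(2)] by blast
    have "t * t * ?P (x + r *\<^sub>R u + s *\<^sub>R v) = t * t * ?Q (x + r' *\<^sub>R v + s' *\<^sub>R u)"
      using rs(3) rs'(3) by (simp add: algebra_simps)
    then have eq: "?P (x + r *\<^sub>R u + s *\<^sub>R v) = ?Q (x + r' *\<^sub>R v + s' *\<^sub>R u)"
      using \<open>t > 0\<close> by simp
    have "dist (?P (x + r *\<^sub>R u + s *\<^sub>R v)) (?P x) < e / 2"
      using d1(2) near[OF rs(1,2)] by (simp add: m_def)
    moreover have "dist (?Q (x + r' *\<^sub>R v + s' *\<^sub>R u)) (?Q x) < e / 2"
    proof -
      have "x + r' *\<^sub>R v + s' *\<^sub>R u = x + s' *\<^sub>R u + r' *\<^sub>R v" by (simp add: algebra_simps)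
      then show ?thesis
        using d2(2)[of "x + s' *\<^sub>R u + r' *\<^sub>R v"] near[OF rs'(2,1)] by (simp only: m_def min_less_iff_conj)
    qed
    ultimately show ?thesis
      unfolding eq by (rule dist_triangle_half_r)
  qed
  then show ?thesis by (meson less_irrefl zero_less_dist_iff)
qed

lemma frechet_derivative_inner_left:
  assumes "F differentiable (at x)"
  shows "frechet_derivative (\<lambda>y. F y \<bullet> b) (at x) v = frechet_derivative F (at x) v \<bullet> b"
    and "(\<lambda>y. F y \<bullet> b) differentiable (at x)"
proof -
  have "((\<lambda>y. F y \<bullet> b) has_derivative (\<lambda>v. frechet_derivative F (at x) v \<bullet> b)) (at x)"
    by (intro has_derivative_inner_left assms[unfolded frechet_derivative_works])
  then show "frechet_derivative (\<lambda>y. F y \<bullet> b) (at x) v = frechet_derivative F (at x) v \<bullet> b"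
    and "(\<lambda>y. F y \<bullet> b) differentiable (at x)"
    using frechet_derivative_at[of "\<lambda>y. F y \<bullet> b"] by (metis, auto intro: differentiableI)
qed

lemma Ck_on_cong:
  assumes "open S" and "Ck_on k S F" and "\<And>y. y \<in> S \<Longrightarrow> F y = G y"
  shows "Ck_on k S G"
  using assms(2,3)
proof (induction k arbitrary: F G)
  case 0
  then show ?case by (auto cong: continuous_on_cong)
next
  case (Suc k)
  have eq: "frechet_derivative F (at y) = frechet_derivative G (at y)" if "y \<in> S" for y
    using frechet_derivative_transform_within_open[OF _ \<open>open S\<close> that] Suc.prems that by auto
  have "G differentiable (at y)" if "y \<in> S" for y
  proof -
    have "(F has_derivative frechet_derivative F (at y)) (at y)"
      using Suc.prems(1) that by (simp add: frechet_derivative_works[symmetric])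
    then have "(G has_derivative frechet_derivative F (at y)) (at y)"
      by (rule has_derivative_transform_within_open[OF _ \<open>open S\<close> that]) (rule Suc.prems(2))
    then show ?thesis by (rule differentiableI)
  qed
  moreover have "Ck_on k S (\<lambda>y. frechet_derivative G (at y) v)" for v
    using Suc.IH[of "\<lambda>y. frechet_derivative F (at y) v"] Suc.prems eq by auto
  ultimately show ?case by simp
qed

lemma Ck_on_inner_left:
  assumes "open S" and "Ck_on k S F"
  shows "Ck_on k S (\<lambda>y. F y \<bullet> b)"
  using assms(2)
proof (induction k arbitrary: F)
  case 0
  then show ?case by (auto intro!: continuous_intros)
next
  case (Suc k)
  have "Ck_on k S (\<lambda>y. frechet_derivative (\<lambda>z. F z \<bullet> b) (at y) v)" for v
  proof (rule Ck_on_cong[OF \<open>open S\<close>])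
    show "Ck_on k S (\<lambda>y. frechet_derivative F (at y) v \<bullet> b)" using Suc by simp
  qed (use Suc.prems in \<open>simp add: frechet_derivative_inner_left\<close>)
  then show ?case using Suc.prems frechet_derivative_inner_left(2) by auto
qed

lemma symmetric_second_derivative:
  fixes F :: "'a::euclidean_space \<Rightarrow> 'b::euclidean_space"
  assumes S: "open S" "x \<in> S" and F: "Ck_on (Suc (Suc 0)) S F"
  shows "frechet_derivative (\<lambda>z. frechet_derivative F (at z) u) (at x) v
       = frechet_derivative (\<lambda>z. frechet_derivative F (at z) v) (at x) u"
proof (rule euclidean_eqI)
  fix b :: 'b
  have component: "frechet_derivative (\<lambda>z. frechet_derivative F (at z) u) (at x) v \<bullet> b
      = frechet_derivative (\<lambda>z. frechet_derivative (\<lambda>y. F y \<bullet> b) (at z) u) (at x) v" for u v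
  proof -
    have "frechet_derivative (\<lambda>z. frechet_derivative F (at z) u) (at x) v \<bullet> b
        = frechet_derivative (\<lambda>z. frechet_derivative F (at z) u \<bullet> b) (at x) v"
      using F S by (simp add: frechet_derivative_inner_left)
    also have "\<dots> = frechet_derivative (\<lambda>z. frechet_derivative (\<lambda>y. F y \<bullet> b) (at z) u) (at x) v"
      using F S by (intro fun_cong[OF frechet_derivative_transform_within_open[OF _ S]])
        (auto simp: frechet_derivative_inner_left)
    finally show ?thesis .
  qed
  show "frechet_derivative (\<lambda>z. frechet_derivative F (at z) u) (at x) v \<bullet> b
      = frechet_derivative (\<lambda>z. frechet_derivative F (at z) v) (at x) u \<bullet> b"
    unfolding component
    by (rule symmetric_second_derivative_real[OF S Ck_on_inner_left[OF S(1) F]])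
qed

section \<open>Non-degenerate bilinear forms\<close>

text \<open>The operator whose inner product with \<open>v\<close> is \<open>b r v\<close>.  It turns statements about representing linear forms by \<open>b\<close>
  into statements about an injective linear operator.\<close>

definition gram_operator :: "('e::euclidean_space \<Rightarrow> 'e \<Rightarrow> real) \<Rightarrow> 'e \<Rightarrow> 'e" where
  "gram_operator b r = (\<Sum>e\<in>Basis. b r e *\<^sub>R e)"

lemma inner_gram_operator:
  assumes "linear (b r)"
  shows "gram_operator b r \<bullet> v = b r v"
proof -
  have "b r v = (\<Sum>e\<in>Basis. (v \<bullet> e) * b r e)"
    by (subst euclidean_representation[of v, symmetric]) (simp add: linear_sum linear_scale assms)
  then show ?thesis
    by (simp add: gram_operator_def inner_sum_left) (simp add: inner_commute mult.commute)
qed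

lemma linear_gram_operator: "bilinear b \<Longrightarrow> linear (gram_operator b)"
  unfolding gram_operator_def
  by (auto intro!: linearI simp: bilinear_ladd bilinear_lmul scaleR_add_left sum.distrib scaleR_sum_right)

lemma inj_gram_operator:
  assumes "bilinear b" and "nondegenerate b"
  shows "inj (gram_operator b)"
proof (rule linear_injective_0[OF linear_gram_operator[OF assms(1)], THEN iffD2], intro allI impI)
  fix r assume "gram_operator b r = 0"
  then have "b r v = 0" for v
    using inner_gram_operator[of b r v] assms(1) by (simp add: bilinear_def)
  then show "r = 0" using assms(2) by (auto simp: nondegenerate_def)
qed

lemma nondegenerate_eqI:
  assumes "bilinear b" and "nondegenerate b" and "\<And>v. b r v = b s v"
  shows "r = s"
proof -
  have "b (r - s) v = 0" for v using assms(1,3) by (simp add: bilinear_lsub)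
  then have "r - s = 0" using assms(2) unfolding nondegenerate_def by blast
  then show ?thesis by simp
qed

lemma nondegenerate_represents:
  assumes "bilinear b" and "nondegenerate b" and "linear l"
  shows "\<exists>r. \<forall>v. b r v = l v"
proof -
  have "surj (gram_operator b)"
    by (intro linear_inj_imp_surj linear_gram_operator inj_gram_operator assms)
  then obtain r where "gram_operator b r = gram_operator (\<lambda>_. l) 0" by (metis surjD)
  then have "b r v = l v" for v
    using inner_gram_operator[of b r v] inner_gram_operator[of "\<lambda>_. l" 0 v] assms
    by (simp add: bilinear_def)
  then show ?thesis by blast
qed

text \<open>If \<open>s\<close> solves a linear system with differentiable coefficients and differentiable right-hand side, and the system is
  invertible at \<open>x\<close>, then \<open>s\<close> is differentiable at \<open>x\<close>.  After inverting the system at \<open>x\<close>, the increment of \<open>s\<close>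
  differs from a differentiable function \<open>w\<close> only by the variation of the coefficients times the increment of \<open>s\<close>
  itself, which can be absorbed near \<open>x\<close>.\<close>

lemma differentiable_nondegenerate_solution:
  fixes b :: "'x::real_normed_vector \<Rightarrow> 'e::euclidean_space \<Rightarrow> 'e \<Rightarrow> real"
  assumes S: "open S" "x \<in> S" and bil: "\<And>y. y \<in> S \<Longrightarrow> bilinear (b y)"
    and nondeg: "nondegenerate (b x)"
    and b: "\<And>u v. (\<lambda>y. b y u v) differentiable (at x)"
    and bs: "\<And>v. (\<lambda>y. b y (s y) v) differentiable (at x)"
  shows "s differentiable (at x)"
proof -
  define M where "M = (\<lambda>y. gram_operator (b y))"
  have linM: "linear (M y)" if "y \<in> S" for y
    unfolding M_def using bil[OF that] by (rule linear_gram_operator)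
  have "inj (M x)"
    unfolding M_def using bil[OF S(2)] nondeg by (rule inj_gram_operator)
  then obtain P where P: "linear P" "P \<circ> M x = id"
    using linear_injective_left_inverse[OF linM[OF S(2)]] by blast
  have diffM: "(\<lambda>y. M y r) differentiable (at x)" for r
    unfolding M_def gram_operator_def using b by (auto intro!: differentiable_sum differentiable_scaleR)
  have diffPM: "(\<lambda>y. P (M y r)) differentiable (at x)" for r
    using differentiable_compose[OF linear_imp_differentiable[OF P(1)] diffM] .
  define w where "w = (\<lambda>y. P (M y (s y)) - P (M y (s x)))"
  have "(\<lambda>y. P (M y (s y))) differentiable (at x)"
    using differentiable_compose[OF linear_imp_differentiable[OF P(1)], of "\<lambda>y. M y (s y)"] bs
    unfolding M_def gram_operator_def by (auto intro!: differentiable_sum differentiable_scaleR)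
  then have "w differentiable (at x)"
    unfolding w_def by (intro differentiable_diff diffPM)
  then obtain w' where w': "(w has_derivative w') (at x)" by (auto simp: differentiable_def)
  have wx: "w x = 0" by (simp add: w_def)
  \<comment> \<open>\<open>E y\<close> bounds the operator norm of the variation of the inverted coefficients between \<open>x\<close> and \<open>y\<close>.\<close>
  define E where "E = (\<lambda>y. \<Sum>e\<in>Basis. norm (P (M y e) - P (M x e)))"
  have "isCont E x"
    unfolding E_def
    by (intro continuous_intros differentiable_imp_continuous_within diffPM)
  moreover have "E x = 0" by (simp add: E_def)
  ultimately have E0: "\<exists>d>0. \<forall>y. norm (y - x) < d \<longrightarrow> norm (E y) < e" if "e > 0" for e
    using that unfolding continuous_at_eps_delta dist_norm by simp
  have PMlin: "linear (\<lambda>r. P (M y r) - P (M x r))" if "y \<in> S" for y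
    using linear_compose_sub[OF linear_compose[OF linM[OF that] P(1)] linear_compose[OF linM[OF S(2)] P(1)]]
    by (simp add: o_def)
  have Ebound: "norm (P (M y r) - P (M x r)) \<le> E y * norm r" if "y \<in> S" for y r
  proof -
    interpret linear "\<lambda>r. P (M y r) - P (M x r)" by (rule PMlin[OF that])
    have "P (M y r) - P (M x r) = (\<Sum>e\<in>Basis. (r \<bullet> e) *\<^sub>R (P (M y e) - P (M x e)))"
      by (subst (1 2) euclidean_representation[of r, symmetric]) (simp only: sum scale)
    also have "norm \<dots> \<le> (\<Sum>e\<in>Basis. \<bar>r \<bullet> e\<bar> * norm (P (M y e) - P (M x e)))"
      by (rule order_trans[OF norm_sum]) simp
    also have "\<dots> \<le> (\<Sum>e\<in>Basis. norm r * norm (P (M y e) - P (M x e)))"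
      by (intro sum_mono mult_right_mono Basis_le_norm) auto
    also have "\<dots> = E y * norm r" by (simp add: E_def sum_distrib_left mult.commute)
    finally show ?thesis .
  qed
  have key: "norm (s y - s x - w y) \<le> E y * norm (s y - s x)" if "y \<in> S" for y
  proof -
    have "w y = P (M y (s y - s x))"
      using linM[OF that] P(1) by (simp add: w_def linear_diff)
    moreover have "P (M x (s y - s x)) = s y - s x" using P(2) by (metis comp_apply id_apply)
    ultimately have "s y - s x - w y = - (P (M y (s y - s x)) - P (M x (s y - s x)))" by simp
    then show ?thesis using Ebound[OF that] by (metis norm_minus_cancel)
  qed
  obtain K where K: "K > 0" "\<And>h. norm (w' h) \<le> norm h * K"
    using bounded_linear.pos_bounded[OF has_derivative_bounded_linear[OF w']] by blast
  have "((\<lambda>y. s y - s x - w y) has_derivative (\<lambda>h. 0)) (at x)"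
    unfolding has_derivative_at_alt
  proof (intro conjI allI impI)
    fix e :: real assume "e > 0"
    \<comment> \<open>The bound \<open>1/2\<close> absorbs the increment of \<open>s\<close>; the other bound makes the remaining error at most \<open>e\<close>.\<close>
    define e' where "e' = min (1/2) (e / (2 * (K + 1)))"
    have "e' > 0" using \<open>e > 0\<close> \<open>K > 0\<close> by (simp add: e'_def)
    then obtain d1 where d1: "d1 > 0" "\<And>y. norm (y - x) < d1 \<Longrightarrow> norm (E y) < e'" using E0 by blast
    obtain d2 where d2: "d2 > 0" "\<And>y. norm (y - x) < d2 \<Longrightarrow> norm (w y - w x - w' (y - x)) \<le> 1 * norm (y - x)"
      using w' unfolding has_derivative_at_alt by (meson zero_less_one)
    obtain d3 where d3: "d3 > 0" "ball x d3 \<subseteq> S" using S open_contains_ball by blast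
    show "\<exists>d>0. \<forall>y. norm (y - x) < d \<longrightarrow>
        norm (s y - s x - w y - (s x - s x - w x) - 0) \<le> e * norm (y - x)"
    proof (intro exI[of _ "min d1 (min d2 d3)"] conjI allI impI)
      fix y assume y: "norm (y - x) < min d1 (min d2 d3)"
      then have "y \<in> S" using d3 by (auto simp: dist_norm norm_minus_commute)
      have "E y \<ge> 0" unfolding E_def by (simp add: sum_nonneg)
      have "norm (w y) \<le> norm (w y - w' (y - x)) + norm (w' (y - x))"
        by (metis diff_add_cancel norm_triangle_ineq)
      then have wy: "norm (w y) \<le> (K + 1) * norm (y - x)"
        using d2(2)[of y] K(2)[of "y - x"] y wx by (simp add: algebra_simps)
      have Ey: "E y \<le> 1/2" "E y \<le> e / (2 * (K + 1))"
        using d1(2)[of y] y \<open>E y \<ge> 0\<close> by (simp_all add: e'_def)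
      have "norm (s y - s x) \<le> norm (w y) + norm (s y - s x - w y)"
        by (metis add.commute diff_add_cancel norm_triangle_ineq)
      also have "\<dots> \<le> norm (w y) + 1/2 * norm (s y - s x)"
        using key[OF \<open>y \<in> S\<close>] mult_right_mono[OF Ey(1), of "norm (s y - s x)"] by simp
      finally have "norm (s y - s x) \<le> 2 * norm (w y)" by simp
      then have "norm (s y - s x - w y) \<le> E y * (2 * norm (w y))"
        using key[OF \<open>y \<in> S\<close>] mult_left_mono[OF _ \<open>E y \<ge> 0\<close>] order_trans by blast
      also have "\<dots> \<le> e / (2 * (K + 1)) * (2 * ((K + 1) * norm (y - x)))"
        using Ey(2) wy \<open>E y \<ge> 0\<close> by (intro mult_mono) auto
      also have "\<dots> = e * norm (y - x)" using \<open>K > 0\<close> by (simp add: field_simps)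
      finally show "norm (s y - s x - w y - (s x - s x - w x) - 0) \<le> e * norm (y - x)"
        using wx by simp
    qed (use d1 d2 d3 in auto)
  qed simp
  then have "((\<lambda>y. (s y - s x - w y) + w y + s x) has_derivative (\<lambda>h. 0 + w' h + 0)) (at x)"
    by (intro has_derivative_add w' has_derivative_const)
  then show ?thesis by (auto simp: differentiable_def)
qed

section \<open>Derivatives in a chart\<close>

definition coord_differentiable ::
    "('m, 'a::euclidean_space) chart \<Rightarrow> ('m \<Rightarrow> 'v::real_normed_vector) \<Rightarrow> 'm \<Rightarrow> bool" where
  "coord_differentiable c F p \<longleftrightarrow> (F \<circ> chart_inv c) differentiable (at (snd c p))"

lemma coord_deriv_works:
  "coord_differentiable c F p \<longleftrightarrow> ((F \<circ> chart_inv c) has_derivative coord_deriv c F p) (at (snd c p))"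
  unfolding coord_differentiable_def frechet_derivative_works
  by (simp add: coord_deriv_def[abs_def])

lemma has_derivative_imp_coord_deriv:
  assumes "((F \<circ> chart_inv c) has_derivative D) (at (snd c p))"
  shows "coord_differentiable c F p" and "coord_deriv c F p = D"
  using assms frechet_derivative_at[OF assms]
  by (auto simp: coord_differentiable_def coord_deriv_def intro: differentiableI)

lemma linear_coord_deriv: "coord_differentiable c F p \<Longrightarrow> linear (coord_deriv c F p)"
  by (rule has_derivative_linear[OF coord_deriv_works[THEN iffD1]])

lemma chart_inv_left:
  assumes "is_chart c" and "q \<in> fst c"
  shows "chart_inv c (snd c q) = q"
  using assms by (simp add: is_chart_def homeomorphism_def)

lemma open_chart_image:
  assumes c: "is_chart c" and W: "open W"
  shows "open (snd c ` (fst c \<inter> W))"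
proof -
  have h: "homeomorphism (fst c) (snd c ` fst c) (snd c) (chart_inv c)" and "open (snd c ` fst c)"
    using c by (auto simp: is_chart_def)
  have "openin (top_of_set (snd c ` fst c)) (snd c ` (fst c \<inter> W))"
    by (rule homeomorphism_imp_open_map[OF h]) (use W in \<open>auto simp: openin_open\<close>)
  then show ?thesis using \<open>open (snd c ` fst c)\<close> openin_open_trans by blast
qed

lemma coord_cong:
  assumes c: "is_chart c" and W: "open W" "p \<in> W" "W \<subseteq> fst c"
    and eq: "\<And>q. q \<in> W \<Longrightarrow> F q = G q" and F: "coord_differentiable c F p"
  shows "coord_differentiable c G p" and "coord_deriv c G p = coord_deriv c F p"
proof -
  have "((F \<circ> chart_inv c) has_derivative coord_deriv c F p) (at (snd c p))"
    using F by (rule coord_deriv_works[THEN iffD1])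
  then have "((G \<circ> chart_inv c) has_derivative coord_deriv c F p) (at (snd c p))"
  proof (rule has_derivative_transform_within_open[OF _ open_chart_image[OF c W(1)]])
    show "snd c p \<in> snd c ` (fst c \<inter> W)" using W by auto
  next
    fix y assume "y \<in> snd c ` (fst c \<inter> W)"
    then show "(F \<circ> chart_inv c) y = (G \<circ> chart_inv c) y" using eq chart_inv_left[OF c] by auto
  qed
  from has_derivative_imp_coord_deriv[OF this]
  show "coord_differentiable c G p" and "coord_deriv c G p = coord_deriv c F p" .
qed

lemma coord_differentiable_const [simp]: "coord_differentiable c (\<lambda>q. v) p"
  and coord_deriv_const [simp]: "coord_deriv c (\<lambda>q. v) p u = 0"
  by (simp_all add: coord_differentiable_def coord_deriv_def o_def)

lemma coord_add:
  assumes "coord_differentiable c F p" "coord_differentiable c G p"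
  shows "coord_differentiable c (\<lambda>q. F q + G q) p"
    and "coord_deriv c (\<lambda>q. F q + G q) p u = coord_deriv c F p u + coord_deriv c G p u"
  using has_derivative_imp_coord_deriv[of "\<lambda>q. F q + G q" c "\<lambda>u. coord_deriv c F p u + coord_deriv c G p u" p]
    has_derivative_add[OF assms[unfolded coord_deriv_works]]
  by (simp_all add: o_def)

lemma coord_minus:
  assumes "coord_differentiable c F p" "coord_differentiable c G p"
  shows "coord_differentiable c (\<lambda>q. F q - G q) p"
    and "coord_deriv c (\<lambda>q. F q - G q) p u = coord_deriv c F p u - coord_deriv c G p u"
  using has_derivative_imp_coord_deriv[of "\<lambda>q. F q - G q" c "\<lambda>u. coord_deriv c F p u - coord_deriv c G p u" p]
    has_derivative_diff[OF assms[unfolded coord_deriv_works]]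
  by (simp_all add: o_def)

lemma coord_scaleR:
  assumes "coord_differentiable c F p"
  shows "coord_differentiable c (\<lambda>q. r *\<^sub>R F q) p"
    and "coord_deriv c (\<lambda>q. r *\<^sub>R F q) p u = r *\<^sub>R coord_deriv c F p u"
  using has_derivative_imp_coord_deriv[of "\<lambda>q. r *\<^sub>R F q" c "\<lambda>u. r *\<^sub>R coord_deriv c F p u" p]
    has_derivative_scaleR_right[OF assms[unfolded coord_deriv_works]]
  by (simp_all add: o_def)

lemma coord_linear_family:
  fixes L :: "'m::topological_space \<Rightarrow> 'e::euclidean_space \<Rightarrow> 'v::real_normed_vector"
  assumes c: "is_chart c" and W: "open W" "p \<in> W" "W \<subseteq> fst c"
    and lin: "\<And>q. q \<in> W \<Longrightarrow> linear (L q)"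
    and L: "\<And>e. coord_differentiable c (\<lambda>q. L q e) p" and a: "coord_differentiable c a p"
  shows "coord_differentiable c (\<lambda>q. L q (a q)) p"
    and "coord_deriv c (\<lambda>q. L q (a q)) p u
       = coord_deriv c (\<lambda>q. L q (a p)) p u + L p (coord_deriv c a p u)"
proof -
  have inv: "chart_inv c (snd c p) = p" using chart_inv_left[OF c] W by auto
  have "((\<lambda>y. L (chart_inv c y) ((a \<circ> chart_inv c) y)) has_derivative
      (\<lambda>h. frechet_derivative (\<lambda>y. L (chart_inv c y) ((a \<circ> chart_inv c) (snd c p))) (at (snd c p)) h
        + L (chart_inv c (snd c p)) (coord_deriv c a p h))) (at (snd c p))"
  proof (rule has_derivative_linear_family[OF open_chart_image[OF c W(1)]])
    show "snd c p \<in> snd c ` (fst c \<inter> W)" using W by auto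
    show "linear (L (chart_inv c y))" if "y \<in> snd c ` (fst c \<inter> W)" for y
      using that chart_inv_left[OF c] lin by auto
    show "(\<lambda>y. L (chart_inv c y) e) differentiable at (snd c p)" for e
      using L[of e] by (simp add: coord_differentiable_def o_def)
    show "((a \<circ> chart_inv c) has_derivative coord_deriv c a p) (at (snd c p))"
      using a by (rule coord_deriv_works[THEN iffD1])
  qed
  then have "((\<lambda>q. L q (a q)) \<circ> chart_inv c has_derivative
      (\<lambda>h. coord_deriv c (\<lambda>q. L q (a p)) p h + L p (coord_deriv c a p h))) (at (snd c p))"
    by (simp add: o_def inv coord_deriv_def)
  from has_derivative_imp_coord_deriv[OF this]
  show "coord_differentiable c (\<lambda>q. L q (a q)) p"
    and "coord_deriv c (\<lambda>q. L q (a q)) p u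
       = coord_deriv c (\<lambda>q. L q (a p)) p u + L p (coord_deriv c a p u)" by simp_all
qed

lemma coord_bilinear_family:
  fixes T :: "'m::topological_space \<Rightarrow> 'e::euclidean_space \<Rightarrow> 'f::euclidean_space \<Rightarrow> 'v::real_normed_vector"
  assumes c: "is_chart c" and W: "open W" "p \<in> W" "W \<subseteq> fst c"
    and bil: "\<And>q. q \<in> W \<Longrightarrow> bilinear (T q)"
    and T: "\<And>e e'. coord_differentiable c (\<lambda>q. T q e e') p"
    and a: "coord_differentiable c a p" and b: "coord_differentiable c b p"
  shows "coord_differentiable c (\<lambda>q. T q (a q) (b q)) p"
    and "coord_deriv c (\<lambda>q. T q (a q) (b q)) p u
       = coord_deriv c (\<lambda>q. T q (a p) (b p)) p u + T p (coord_deriv c a p u) (b p)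
         + T p (a p) (coord_deriv c b p u)"
proof -
  have lin1: "linear (\<lambda>x. T q x e)" and lin2: "linear (T q x)" if "q \<in> W" for q e x
    using bil[OF that] by (simp_all add: bilinear_def)
  note 1 = coord_linear_family[OF c W, of "\<lambda>q x. T q x e" a for e, OF lin1 T a]
  note 2 = coord_linear_family[OF c W, of "\<lambda>q. T q (a q)" b, OF lin2 1(1) b]
  show "coord_differentiable c (\<lambda>q. T q (a q) (b q)) p" by (rule 2(1))
  show "coord_deriv c (\<lambda>q. T q (a q) (b q)) p u
       = coord_deriv c (\<lambda>q. T q (a p) (b p)) p u + T p (coord_deriv c a p u) (b p)
         + T p (a p) (coord_deriv c b p u)"
    by (simp add: 2(2) 1(2))
qed

text \<open>Used for the Christoffel symbols and for the shape tensor, both of which are known only through their products with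
  the metric.\<close>

lemma coord_nondegenerate_solution:
  fixes b :: "'m::topological_space \<Rightarrow> 'e::euclidean_space \<Rightarrow> 'e \<Rightarrow> real"
  assumes c: "is_chart c" and W: "open W" "p \<in> W" "W \<subseteq> fst c"
    and bil: "\<And>q. q \<in> W \<Longrightarrow> bilinear (b q)" and nondeg: "nondegenerate (b p)"
    and b: "\<And>e e'. coord_differentiable c (\<lambda>q. b q e e') p"
    and bs: "\<And>e. coord_differentiable c (\<lambda>q. b q (s q) e) p"
  shows "coord_differentiable c s p"
proof -
  have "(s \<circ> chart_inv c) differentiable (at (snd c p))"
  proof (rule differentiable_nondegenerate_solution[OF open_chart_image[OF c W(1)], where b = "b \<circ> chart_inv c"])
    show "snd c p \<in> snd c ` (fst c \<inter> W)" using W by auto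
    show "bilinear ((b \<circ> chart_inv c) y)" if "y \<in> snd c ` (fst c \<inter> W)" for y
      using that chart_inv_left[OF c] bil by auto
    show "nondegenerate ((b \<circ> chart_inv c) (snd c p))"
      using chart_inv_left[OF c] W nondeg by auto
  qed (use b bs in \<open>simp_all add: coord_differentiable_def o_def\<close>)
  then show ?thesis by (simp add: coord_differentiable_def)
qed

lemma coord_chain:
  fixes F :: "'k::topological_space \<Rightarrow> 'v::real_normed_vector"
  assumes c: "is_chart c" and d: "is_chart d" and W: "open W" "p \<in> W" "W \<subseteq> fst c" "f ` W \<subseteq> fst d"
    and f: "coord_differentiable c (snd d \<circ> f) p" and F: "coord_differentiable d F (f p)"
  shows "coord_differentiable c (\<lambda>q. F (f q)) p"
    and "coord_deriv c (\<lambda>q. F (f q)) p u = coord_deriv d F (f p) (differential c d f p u)"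
proof -
  have inv: "chart_inv c (snd c p) = p" using chart_inv_left[OF c] W by auto
  have "((snd d \<circ> f \<circ> chart_inv c) has_derivative differential c d f p) (at (snd c p))"
    using f unfolding coord_deriv_works by (simp add: differential_def[abs_def])
  moreover have "((F \<circ> chart_inv d) has_derivative coord_deriv d F (f p)) (at ((snd d \<circ> f \<circ> chart_inv c) (snd c p)))"
    using F unfolding coord_deriv_works by (simp add: inv)
  ultimately have "((F \<circ> chart_inv d) \<circ> (snd d \<circ> f \<circ> chart_inv c) has_derivative
      coord_deriv d F (f p) \<circ> differential c d f p) (at (snd c p))"
    by (rule diff_chain_at)
  then have "((\<lambda>q. F (f q)) \<circ> chart_inv c has_derivative
      coord_deriv d F (f p) \<circ> differential c d f p) (at (snd c p))"
  proof (rule has_derivative_transform_within_open[OF _ open_chart_image[OF c W(1)]])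
    show "snd c p \<in> snd c ` (fst c \<inter> W)" using W by auto
    fix y assume "y \<in> snd c ` (fst c \<inter> W)"
    then obtain q where q: "q \<in> W" "y = snd c q" "chart_inv c y = q" using chart_inv_left[OF c] by auto
    then have "chart_inv d (snd d (f q)) = f q" using chart_inv_left[OF d] W(4) by auto
    with q show "((F \<circ> chart_inv d) \<circ> (snd d \<circ> f \<circ> chart_inv c)) y = ((\<lambda>q. F (f q)) \<circ> chart_inv c) y"
      by simp
  qed
  from has_derivative_imp_coord_deriv[OF this]
  show "coord_differentiable c (\<lambda>q. F (f q)) p"
    and "coord_deriv c (\<lambda>q. F (f q)) p u = coord_deriv d F (f p) (differential c d f p u)" by simp_all
qed

lemma smooth_in_subset: "smooth_in c W F \<Longrightarrow> W' \<subseteq> W \<Longrightarrow> smooth_in c W' F"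
  unfolding smooth_in_def smooth_on_def by (blast intro: Ck_on_subset)

lemma smooth_in_differentiable:
  assumes F: "smooth_in c W F" and p: "p \<in> W" "p \<in> fst c"
  shows "coord_differentiable c F p"
proof -
  have "Ck_on (Suc 0) (snd c ` (fst c \<inter> W)) (F \<circ> chart_inv c)"
    using F unfolding smooth_in_def smooth_on_def by blast
  then show ?thesis using p unfolding coord_differentiable_def by auto
qed

lemma smooth_in_coord_deriv:
  assumes c: "is_chart c" and W: "open W" and F: "smooth_in c W F"
  shows "smooth_in c W (\<lambda>q. coord_deriv c F q v)"
proof -
  have "Ck_on k (snd c ` (fst c \<inter> W)) ((\<lambda>q. coord_deriv c F q v) \<circ> chart_inv c)" for k
  proof (rule Ck_on_cong[OF open_chart_image[OF c W]])
    have "Ck_on (Suc k) (snd c ` (fst c \<inter> W)) (F \<circ> chart_inv c)"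
      using F unfolding smooth_in_def smooth_on_def by blast
    then show "Ck_on k (snd c ` (fst c \<inter> W)) (\<lambda>y. frechet_derivative (F \<circ> chart_inv c) (at y) v)"
      by simp
  qed (auto simp: coord_deriv_def chart_inv_left[OF c])
  then show ?thesis by (simp add: smooth_in_def smooth_on_def)
qed

text \<open>Coordinate fields commute.  This is the source of the symmetry of the second fundamental form.\<close>

lemma coord_deriv_symmetric:
  fixes F :: "'m::topological_space \<Rightarrow> 'b::euclidean_space"
  assumes c: "is_chart c" and W: "open W" and F: "smooth_in c W F" and p: "p \<in> W" "p \<in> fst c"
  shows "coord_deriv c (\<lambda>q. coord_deriv c F q v) p u = coord_deriv c (\<lambda>q. coord_deriv c F q u) p v"
proof -
  let ?S = "snd c ` (fst c \<inter> W)" and ?F = "F \<circ> chart_inv c"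
  have S: "open ?S" "snd c p \<in> ?S" using open_chart_image[OF c W] p by auto
  have Ck: "Ck_on (Suc (Suc 0)) ?S ?F"
    using F unfolding smooth_in_def smooth_on_def by blast
  have "coord_deriv c (\<lambda>q. coord_deriv c F q v) p u
      = frechet_derivative (\<lambda>z. frechet_derivative ?F (at z) v) (at (snd c p)) u" for u v
    unfolding coord_deriv_def[of c "\<lambda>q. coord_deriv c F q v"]
  proof (intro fun_cong[OF frechet_derivative_transform_within_open[OF _ S, symmetric]])
    show "(\<lambda>z. frechet_derivative ?F (at z) v) differentiable at (snd c p)" using Ck S(2) by auto
  qed (auto simp: coord_deriv_def chart_inv_left[OF c])
  then show ?thesis using symmetric_second_derivative[OF S Ck] by simp
qed

section \<open>The Levi-Civita connection of a metric in a chart\<close>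

text \<open>A metric restricted to one chart, where the connection becomes a field of symmetric bilinear maps (its Christoffel
  symbols).\<close>

locale chart_metric =
  fixes c :: "('m::topological_space, 'a::euclidean_space) chart" and g :: "('m, 'a) bilin_field"
  assumes chart: "is_chart c"
    and bilinear_metric: "\<And>q. q \<in> fst c \<Longrightarrow> bilinear (g c q)"
    and metric_commute: "\<And>q u v. q \<in> fst c \<Longrightarrow> g c q u v = g c q v u"
    and nondegenerate_metric: "\<And>q. q \<in> fst c \<Longrightarrow> nondegenerate (g c q)"
    and smooth_metric: "\<And>u v. smooth_in c UNIV (\<lambda>q. g c q u v)"
begin

lemma open_domain: "open (fst c)"
  using chart by (simp add: is_chart_def)

lemma metric_differentiable: "q \<in> fst c \<Longrightarrow> coord_differentiable c (\<lambda>q. g c q u v) q"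
  by (rule smooth_in_differentiable[OF smooth_metric]) auto

definition metric_deriv :: "'m \<Rightarrow> 'a \<Rightarrow> 'a \<Rightarrow> 'a \<Rightarrow> real" where
  "metric_deriv q u v w = coord_deriv c (\<lambda>q. g c q v w) q u"

lemma metric_deriv_commute: "q \<in> fst c \<Longrightarrow> metric_deriv q u v w = metric_deriv q u w v"
  unfolding metric_deriv_def
  by (rule fun_cong[OF coord_cong(2)[OF chart open_domain, of _ "\<lambda>q. g c q w v"]])
    (auto simp: metric_commute metric_differentiable)

lemma linear_metric_deriv_1: "q \<in> fst c \<Longrightarrow> linear (\<lambda>u. metric_deriv q u v w)"
  using linear_coord_deriv[OF metric_differentiable] by (simp add: metric_deriv_def)

lemma linear_metric_deriv_3: 
  assumes q: "q \<in> fst c" shows "linear (metric_deriv q u v)"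
proof (rule linearI)
  fix w w' :: 'a and r :: real
  note cong = fun_cong[OF coord_cong(2)[OF chart open_domain q order_refl]]
  have "metric_deriv q u v (w + w') = coord_deriv c (\<lambda>q. g c q v w + g c q v w') q u"
    unfolding metric_deriv_def
    by (rule cong) (auto simp: bilinear_radd bilinear_metric intro!: coord_add metric_differentiable q)
  then show "metric_deriv q u v (w + w') = metric_deriv q u v w + metric_deriv q u v w'"
    by (simp add: coord_add(2) metric_differentiable q metric_deriv_def)
  have "metric_deriv q u v (r *\<^sub>R w) = coord_deriv c (\<lambda>q. r *\<^sub>R g c q v w) q u"
    unfolding metric_deriv_def
    by (rule cong) (auto simp: bilinear_rmul bilinear_metric simp del: real_scaleR_def
        intro!: coord_scaleR metric_differentiable q)
  then show "metric_deriv q u v (r *\<^sub>R w) = r *\<^sub>R metric_deriv q u v w"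
    by (simp add: coord_scaleR(2) metric_differentiable q metric_deriv_def del: real_scaleR_def)
qed

lemma linear_metric_deriv_2:
  assumes q: "q \<in> fst c" shows "linear (\<lambda>v. metric_deriv q u v w)"
proof -
  have "(\<lambda>v. metric_deriv q u v w) = metric_deriv q u w"
    by (rule ext) (rule metric_deriv_commute[OF q])
  then show ?thesis using linear_metric_deriv_3[OF q] by simp
qed

definition koszul :: "'m \<Rightarrow> 'a \<Rightarrow> 'a \<Rightarrow> 'a \<Rightarrow> real" where
  "koszul q u v w = (metric_deriv q u v w + metric_deriv q v u w - metric_deriv q w u v) / 2"

text \<open>The Koszul formula: three cyclic copies of the metric condition, combined with symmetry, determine the connection.\<close>

lemma koszul_unique:
  assumes q: "q \<in> fst c" and sym: "\<And>u v. \<Gamma> u v = \<Gamma> v u"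
    and metric: "\<And>u v w. metric_deriv q u v w = g c q (\<Gamma> u v) w + g c q v (\<Gamma> u w)"
  shows "g c q (\<Gamma> u v) w = koszul q u v w"
  using metric[of u v w] metric[of v u w] metric[of w u v] sym[of v u] sym[of w u] sym[of w v]
    metric_commute[OF q, of v "\<Gamma> u w"] metric_commute[OF q, of u "\<Gamma> v w"]
  by (simp add: koszul_def)

lemma levi_civita_exists:
  assumes q: "q \<in> fst c"
  shows "\<exists>\<Gamma>. bilinear \<Gamma> \<and> (\<forall>u v. \<Gamma> u v = \<Gamma> v u) \<and>
    (\<forall>u v w. metric_deriv q u v w = g c q (\<Gamma> u v) w + g c q v (\<Gamma> u w))"
proof -
  note D = linear_metric_deriv_1[OF q] linear_metric_deriv_2[OF q] linear_metric_deriv_3[OF q]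
  have "linear (koszul q u v)" for u v
    unfolding koszul_def[abs_def]
    by (rule linearI) (simp_all add: D[THEN linear_add] D[THEN linear_scale] field_simps)
  then have "\<exists>r. \<forall>w. g c q r w = koszul q u v w" for u v
    by (rule nondegenerate_represents[OF bilinear_metric[OF q] nondegenerate_metric[OF q]])
  then obtain \<Gamma> where \<Gamma>: "\<And>u v w. g c q (\<Gamma> u v) w = koszul q u v w" by metis
  note eqI = nondegenerate_eqI[OF bilinear_metric[OF q] nondegenerate_metric[OF q]]
  have sym: "\<Gamma> u v = \<Gamma> v u" for u v
    by (rule eqI) (simp add: \<Gamma> koszul_def metric_deriv_commute[OF q, of _ u v])
  have lin: "linear (\<lambda>u. \<Gamma> u v)" for v
  proof (rule linearI)
    show "\<Gamma> (u + u') v = \<Gamma> u v + \<Gamma> u' v" for u u'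
      by (rule eqI) (simp add: \<Gamma> bilinear_ladd[OF bilinear_metric[OF q]] koszul_def
        D[THEN linear_add] field_simps)
    show "\<Gamma> (r *\<^sub>R u) v = r *\<^sub>R \<Gamma> u v" for r u
      by (rule eqI) (simp add: \<Gamma> bilinear_lmul[OF bilinear_metric[OF q]] koszul_def
        D[THEN linear_scale] field_simps)
  qed
  have "linear (\<Gamma> u)" for u
  proof -
    have "\<Gamma> u = (\<lambda>v. \<Gamma> v u)" by (rule ext) (rule sym)
    then show ?thesis using lin[of u] by simp
  qed
  with lin have "bilinear \<Gamma>" by (simp add: bilinear_def)
  moreover have "metric_deriv q u v w = g c q (\<Gamma> u v) w + g c q v (\<Gamma> u w)" for u v w
    using metric_commute[OF q, of v "\<Gamma> u w"]
      metric_deriv_commute[OF q, of u v w] metric_deriv_commute[OF q, of v u w]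
      metric_deriv_commute[OF q, of w u v]
    by (simp add: \<Gamma> koszul_def field_simps)
  ultimately show ?thesis using sym by blast
qed

lemma levi_civita_works:
  assumes q: "q \<in> fst c"
  shows "bilinear (levi_civita g c q)"
    and "levi_civita g c q u v = levi_civita g c q v u"
    and "coord_deriv c (\<lambda>q. g c q v w) q u
      = g c q (levi_civita g c q u v) w + g c q v (levi_civita g c q u w)"
proof -
  let ?P = "\<lambda>\<Gamma>. bilinear \<Gamma> \<and> (\<forall>u v. \<Gamma> u v = \<Gamma> v u) \<and>
    (\<forall>u v w. coord_deriv c (\<lambda>q. g c q v w) q u = g c q (\<Gamma> u v) w + g c q v (\<Gamma> u w))"
  have "\<exists>!\<Gamma>. ?P \<Gamma>"
  proof (rule ex_ex1I)
    show "\<exists>\<Gamma>. ?P \<Gamma>" using levi_civita_exists[OF q] unfolding metric_deriv_def .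
    fix \<Gamma> \<Gamma>' assume P: "?P \<Gamma>" "?P \<Gamma>'"
    have "g c q (\<Gamma> u v) w = koszul q u v w" for u v w
      by (rule koszul_unique[OF q]) (use P(1) in \<open>unfold metric_deriv_def, blast+\<close>)
    moreover have "g c q (\<Gamma>' u v) w = koszul q u v w" for u v w
      by (rule koszul_unique[OF q]) (use P(2) in \<open>unfold metric_deriv_def, blast+\<close>)
    ultimately have "g c q (\<Gamma> u v) w = g c q (\<Gamma>' u v) w" for u v w by simp
    then have "\<Gamma> u v = \<Gamma>' u v" for u v
      by (rule nondegenerate_eqI[OF bilinear_metric[OF q] nondegenerate_metric[OF q]])
    then show "\<Gamma> = \<Gamma>'" by blast
  qed
  then have "?P (levi_civita g c q)"
    unfolding levi_civita_def by (rule theI')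
  then show "bilinear (levi_civita g c q)"
    and "levi_civita g c q u v = levi_civita g c q v u"
    and "coord_deriv c (\<lambda>q. g c q v w) q u
      = g c q (levi_civita g c q u v) w + g c q v (levi_civita g c q u w)" by blast+
qed

lemma metric_levi_civita:
  "q \<in> fst c \<Longrightarrow> g c q (levi_civita g c q u v) w = koszul q u v w"
  by (rule koszul_unique[OF _ levi_civita_works(2)]) (simp_all add: metric_deriv_def levi_civita_works(3))

lemma levi_civita_unique:
  assumes q: "q \<in> fst c" and "\<And>u v. \<Gamma> u v = \<Gamma> v u"
    and "\<And>u v w. coord_deriv c (\<lambda>q. g c q v w) q u = g c q (\<Gamma> u v) w + g c q v (\<Gamma> u w)"
  shows "levi_civita g c q u v = \<Gamma> u v"
proof (rule nondegenerate_eqI[OF bilinear_metric[OF q] nondegenerate_metric[OF q]])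
  have "g c q (\<Gamma> u v) w = koszul q u v w" for w
    by (rule koszul_unique[OF q assms(2)]) (simp add: metric_deriv_def assms(3))
  then show "g c q (levi_civita g c q u v) w = g c q (\<Gamma> u v) w" for w
    by (simp add: metric_levi_civita[OF q])
qed

lemma levi_civita_differentiable:
  assumes p: "p \<in> fst c"
  shows "coord_differentiable c (\<lambda>q. levi_civita g c q u v) p"
proof (rule coord_nondegenerate_solution[OF chart open_domain p order_refl bilinear_metric
      nondegenerate_metric[OF p] metric_differentiable[OF p]])
  fix w
  have D: "coord_differentiable c (\<lambda>q. metric_deriv q u v w) p" for u v w
    unfolding metric_deriv_def
    by (rule smooth_in_differentiable[OF smooth_in_coord_deriv[OF chart open_UNIV smooth_metric]])
      (use p in auto)
  have "coord_differentiable c (\<lambda>q. (1/2) *\<^sub>R (metric_deriv q u v w + metric_deriv q v u w - metric_deriv q w u v)) p"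
    by (intro coord_scaleR coord_add coord_minus D)
  then show "coord_differentiable c (\<lambda>q. g c q (levi_civita g c q u v) w) p"
    by (rule coord_cong(1)[OF chart open_domain p order_refl, rotated])
      (simp add: metric_levi_civita koszul_def)
qed

end

section \<open>The Gauss formula for an immersion\<close>

text \<open>An immersion seen in one chart of the source and one chart of the target.  The open set \<open>U\<close> is where both charts and
  the data on the target are available.\<close>

locale immersion_charts = M: chart_metric c g + N: chart_metric d gt
  for c :: "('m::topological_space, 'a::euclidean_space) chart" and g :: "('m, 'a) bilin_field"
    and d :: "('k::topological_space, 'b::euclidean_space) chart" and gt :: "('k, 'b) bilin_field" +
  fixes f :: "'m \<Rightarrow> 'k" and U :: "'m set"
  assumes open_U: "open U" and U_domain: "U \<subseteq> fst c" and U_image: "f ` U \<subseteq> fst d"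
    and smooth_map: "smooth_in c U (snd d \<circ> f)"
    and inj_differential: "\<And>q. q \<in> U \<Longrightarrow> inj (differential c d f q)"
    and induced: "\<And>q u v. q \<in> U \<Longrightarrow> g c q u v = gt d (f q) (differential c d f q u) (differential c d f q v)"
begin

abbreviation tangent :: "'m \<Rightarrow> 'a \<Rightarrow> 'b" where
  "tangent \<equiv> differential c d f"

abbreviation nabla :: "('m \<Rightarrow> 'b) \<Rightarrow> 'm \<Rightarrow> 'a \<Rightarrow> 'b" where
  "nabla \<equiv> nabla_along c d f gt"

abbreviation sff :: "'m \<Rightarrow> 'a \<Rightarrow> 'a \<Rightarrow> 'b" where
  "sff \<equiv> second_fundamental_form c d f gt"

definition normal_at :: "'m \<Rightarrow> 'b \<Rightarrow> bool" where
  "normal_at q w \<longleftrightarrow> (\<forall>u. gt d (f q) w (tangent q u) = 0)"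

lemma U_dom: "q \<in> U \<Longrightarrow> q \<in> fst c" and U_im: "q \<in> U \<Longrightarrow> f q \<in> fst d"
  using U_domain U_image by auto

lemma map_differentiable: "q \<in> U \<Longrightarrow> coord_differentiable c (snd d \<circ> f) q"
  by (rule smooth_in_differentiable[OF smooth_map]) (auto dest: U_dom)

lemma linear_tangent: "q \<in> U \<Longrightarrow> linear (tangent q)"
  using linear_coord_deriv[OF map_differentiable] by (simp add: differential_def[abs_def])

lemma tangent_differentiable:
  assumes "q \<in> U" shows "coord_differentiable c (\<lambda>q. tangent q v) q"
  unfolding differential_def
  by (rule smooth_in_differentiable[OF smooth_in_coord_deriv[OF M.chart open_U smooth_map]])
    (use assms U_dom in auto)

lemma coord_deriv_tangent_commute:
  "q \<in> U \<Longrightarrow> coord_deriv c (\<lambda>q. tangent q v) q u = coord_deriv c (\<lambda>q. tangent q u) q v"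
  unfolding differential_def
  by (rule coord_deriv_symmetric[OF M.chart open_U smooth_map]) (auto dest: U_dom)

lemma restrict_ambient:
  assumes "q \<in> U" and "coord_differentiable d F (f q)"
  shows "coord_differentiable c (\<lambda>q. F (f q)) q"
    and "coord_deriv c (\<lambda>q. F (f q)) q u = coord_deriv d F (f q) (tangent q u)"
  using coord_chain[OF M.chart N.chart open_U assms(1) U_domain U_image map_differentiable[OF assms(1)] assms(2)]
  by auto

lemmas ambient_bilinear = N.bilinear_metric[OF U_im]
lemmas ambient_commute = N.metric_commute[OF U_im]

lemma normal_at_diff: "q \<in> U \<Longrightarrow> normal_at q w \<Longrightarrow> normal_at q w' \<Longrightarrow> normal_at q (w - w')"
  by (simp add: normal_at_def bilinear_lsub ambient_bilinear)

text \<open>A tangent vector orthogonal to all tangent vectors is zero because the induced metric is non-degenerate; hence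
  splittings into tangent and normal parts are unique.\<close>

lemma tangent_normal_zero:
  assumes q: "q \<in> U" and "normal_at q (tangent q u)"
  shows "u = 0"
proof -
  have "g c q u v = 0" for v
    using assms by (simp add: normal_at_def induced)
  then show ?thesis using M.nondegenerate_metric[OF U_dom[OF q]] by (auto simp: nondegenerate_def)
qed

lemma decomposition_unique:
  assumes q: "q \<in> U" and eq: "tangent q u + n = tangent q u' + n'" and "normal_at q n" "normal_at q n'"
  shows "u = u'" and "n = n'"
proof -
  have "tangent q (u - u') = n' - n"
    using eq by (simp add: linear_diff[OF linear_tangent[OF q]] algebra_simps)
  then have "normal_at q (tangent q (u - u'))" using assms normal_at_diff by simp
  then have "u - u' = 0" by (rule tangent_normal_zero[OF q])
  then show "u = u'" by simp
  with eq show "n = n'" by simp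
qed

lemma tangential_part_eqI:
  assumes q: "q \<in> U" and n: "normal_at q n"
  shows "tangential_part c d f gt q (tangent q u + n) = tangent q u"
  unfolding tangential_part_def
proof (rule the_equality)
  show "tangent q u \<in> range (tangent q) \<and> (\<forall>ua. gt d (f q) (tangent q u + n - tangent q u) (tangent q ua) = 0)"
    using n by (simp add: normal_at_def)
  fix t assume t: "t \<in> range (tangent q) \<and> (\<forall>ua. gt d (f q) (tangent q u + n - t) (tangent q ua) = 0)"
  then obtain u' where u': "t = tangent q u'" by auto
  have "u' = u"
    by (rule decomposition_unique(1)[OF q, of u' "tangent q u + n - t" u n])
      (use t u' n in \<open>auto simp: normal_at_def\<close>)
  then show "t = tangent q u" using u' by simp
qed

lemma normal_part_eqI:
  "q \<in> U \<Longrightarrow> normal_at q n \<Longrightarrow> normal_part c d f gt q (tangent q u + n) = n"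
  by (simp add: normal_part_def tangential_part_eqI)

lemma decomposition_exists:
  assumes q: "q \<in> U"
  obtains u n where "w = tangent q u + n" and "normal_at q n" and "normal_part c d f gt q w = n"
proof -
  have "linear (\<lambda>u. gt d (f q) w (tangent q u))"
    using linear_compose[OF linear_tangent[OF q], of "gt d (f q) w"] ambient_bilinear[OF q]
    by (simp add: bilinear_def o_def)
  then obtain u where u: "\<And>v. g c q u v = gt d (f q) w (tangent q v)"
    using nondegenerate_represents[OF M.bilinear_metric M.nondegenerate_metric, OF U_dom[OF q] U_dom[OF q]] by blast
  have "normal_at q (w - tangent q u)"
    using u by (simp add: normal_at_def bilinear_lsub[OF ambient_bilinear[OF q]] induced[OF q, symmetric])
  from that[of u "w - tangent q u"] normal_part_eqI[OF q this, of u] this show thesis by simp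
qed

lemma nabla_linear:
  assumes q: "q \<in> U" and Z: "coord_differentiable c Z q"
  shows "linear (nabla Z q)"
proof -
  note L = linear_coord_deriv[OF Z] linear_tangent[OF q]
  note \<Gamma> = N.levi_civita_works(1)[OF U_im[OF q]]
  show ?thesis
    unfolding nabla_along_def[abs_def]
    by (rule linearI) (simp_all add: L[THEN linear_add] L[THEN linear_scale] bilinear_ladd[OF \<Gamma>]
      bilinear_lmul[OF \<Gamma>] scaleR_add_right)
qed

lemma nabla_cong:
  assumes "q \<in> U" and "\<And>q. q \<in> U \<Longrightarrow> Z q = Y q" and "coord_differentiable c Z q"
  shows "nabla Y q u = nabla Z q u"
  using coord_cong(2)[OF M.chart open_U assms(1) U_domain assms(2,3)] assms(1,2)
  by (simp add: nabla_along_def)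

lemma nabla_metric:
  assumes q: "q \<in> U" and Z: "coord_differentiable c Z q" and Y: "coord_differentiable c Y q"
  shows "coord_deriv c (\<lambda>q. gt d (f q) (Z q) (Y q)) q u
    = gt d (f q) (nabla Z q u) (Y q) + gt d (f q) (Z q) (nabla Y q u)"
proof -
  note bil = ambient_bilinear[OF q]
  note D = restrict_ambient[OF q N.metric_differentiable[OF U_im[OF q]]]
  have "coord_deriv c (\<lambda>q. gt d (f q) (Z q) (Y q)) q u
      = coord_deriv c (\<lambda>r. gt d (f r) (Z q) (Y q)) q u + gt d (f q) (coord_deriv c Z q u) (Y q)
        + gt d (f q) (Z q) (coord_deriv c Y q u)"
    by (rule coord_bilinear_family(2)[OF M.chart open_U q U_domain ambient_bilinear D(1) Z Y])
  then show ?thesis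
    by (simp add: D(2) N.levi_civita_works(3)[OF U_im[OF q]] nabla_along_def
      bilinear_ladd[OF bil] bilinear_radd[OF bil])
qed

lemma nabla_endo:
  assumes q: "q \<in> U" and lin: "\<And>q. q \<in> U \<Longrightarrow> linear (S d (f q))"
    and S: "\<And>v. coord_differentiable d (\<lambda>r. S d r v) (f q)" and Z: "coord_differentiable c Z q"
  shows "coord_differentiable c (\<lambda>q. S d (f q) (Z q)) q"
    and "nabla (\<lambda>q. S d (f q) (Z q)) q u
      = nabla_endo gt d S (f q) (tangent q u) (Z q) + S d (f q) (nabla Z q u)"
proof -
  note 1 = coord_linear_family[OF M.chart open_U q U_domain lin restrict_ambient(1)[OF q S] Z]
  show "coord_differentiable c (\<lambda>q. S d (f q) (Z q)) q" by (rule 1)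
  show "nabla (\<lambda>q. S d (f q) (Z q)) q u
      = nabla_endo gt d S (f q) (tangent q u) (Z q) + S d (f q) (nabla Z q u)"
    by (simp add: nabla_along_def nabla_endo_def 1(2) restrict_ambient(2)[OF q S] linear_add[OF lin[OF q]])
qed

lemma nabla_tangent_commute: "q \<in> U \<Longrightarrow> nabla (\<lambda>q. tangent q v) q u = nabla (\<lambda>q. tangent q u) q v"
  using coord_deriv_tangent_commute[of q v u] N.levi_civita_works(2)[OF U_im, of q]
  by (simp add: nabla_along_def)

text \<open>The tangential part of the ambient derivative of coordinate fields is symmetric and compatible with the induced
  metric, so it is the Levi-Civita connection of that metric.\<close>

lemma gauss_formula:
  assumes q: "q \<in> U"
  shows "nabla (\<lambda>q. tangent q v) q u = tangent q (levi_civita g c q u v) + sff q u v"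
    and "normal_at q (sff q u v)"
proof -
  have "\<exists>t. nabla (\<lambda>q. tangent q v) q u = tangent q t + sff q u v \<and> normal_at q (sff q u v)" for u v
  proof -
    obtain t n where tn: "nabla (\<lambda>q. tangent q v) q u = tangent q t + n" "normal_at q n"
      "normal_part c d f gt q (nabla (\<lambda>q. tangent q v) q u) = n"
      by (rule decomposition_exists[OF q])
    have "sff q u v = n" using tn(3) by (simp add: second_fundamental_form_def)
    then show ?thesis using tn(1,2) by (intro exI[of _ t]) simp
  qed
  then have "\<forall>u. \<exists>\<Gamma>. \<forall>v. nabla (\<lambda>q. tangent q v) q u = tangent q (\<Gamma> v) + sff q u v \<and> normal_at q (sff q u v)"
    by (intro allI choice)
  from choice[OF this] obtain \<Gamma>
    where \<Gamma>: "\<And>u v. nabla (\<lambda>q. tangent q v) q u = tangent q (\<Gamma> u v) + sff q u v"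
    and n: "\<And>u v. normal_at q (sff q u v)" by blast
  note bil = ambient_bilinear[OF q]
  have "\<Gamma> u v = \<Gamma> v u" for u v
    by (rule decomposition_unique(1)[OF q _ n n, of _ u v _ v u])
      (simp add: \<Gamma>[symmetric] nabla_tangent_commute[OF q, of v u])
  moreover have "coord_deriv c (\<lambda>q. g c q v w) q u = g c q (\<Gamma> u v) w + g c q v (\<Gamma> u w)" for u v w
  proof -
    have "coord_deriv c (\<lambda>q. g c q v w) q u = coord_deriv c (\<lambda>q. gt d (f q) (tangent q v) (tangent q w)) q u"
      by (rule fun_cong[OF coord_cong(2)[OF M.chart open_U q U_domain, symmetric]])
        (simp_all add: induced M.metric_differentiable U_dom[OF q])
    also have "\<dots> = gt d (f q) (nabla (\<lambda>q. tangent q v) q u) (tangent q w)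
        + gt d (f q) (tangent q v) (nabla (\<lambda>q. tangent q w) q u)"
      by (intro nabla_metric[OF q] tangent_differentiable q)
    also have "\<dots> = g c q (\<Gamma> u v) w + g c q v (\<Gamma> u w)"
      using n[of u v] n[of u w] ambient_commute[OF q, of _ "sff q u w"]
      by (simp add: \<Gamma> bilinear_ladd[OF bil] bilinear_radd[OF bil] induced[OF q] normal_at_def)
    finally show ?thesis .
  qed
  ultimately have "levi_civita g c q u v = \<Gamma> u v" for u v
    by (rule M.levi_civita_unique[OF U_dom[OF q]])
  with \<Gamma> n show "nabla (\<lambda>q. tangent q v) q u = tangent q (levi_civita g c q u v) + sff q u v"
    and "normal_at q (sff q u v)" by simp_all
qed

lemma sff_eq: "q \<in> U \<Longrightarrow> sff q u v = nabla (\<lambda>q. tangent q v) q u - tangent q (levi_civita g c q u v)"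
  by (simp add: gauss_formula)

lemma sff_commute: "q \<in> U \<Longrightarrow> sff q u v = sff q v u"
  by (simp add: sff_eq nabla_tangent_commute[of q v u] M.levi_civita_works(2)[OF U_dom, of q u v])

lemma linear_sff:
  assumes q: "q \<in> U" shows "linear (\<lambda>u. sff q u v)"
proof -
  have "linear (\<lambda>u. tangent q (levi_civita g c q u v))"
    using linear_compose[OF _ linear_tangent[OF q], of "\<lambda>u. levi_civita g c q u v"]
      M.levi_civita_works(1)[OF U_dom[OF q]] by (simp add: bilinear_def o_def)
  from linear_compose_sub[OF nabla_linear[OF q tangent_differentiable[OF q]] this]
  show ?thesis by (simp add: sff_eq[OF q])
qed

lemma bilinear_sff:
  assumes q: "q \<in> U" shows "bilinear (sff q)"
proof -
  have "sff q u = (\<lambda>v. sff q v u)" for u by (rule ext) (rule sff_commute[OF q])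
  then show ?thesis using linear_sff[OF q] by (metis bilinear_def)
qed

lemma tangent_field_differentiable:
  assumes q: "q \<in> U" and X: "coord_differentiable c X q"
  shows "coord_differentiable c (\<lambda>q. tangent q (X q)) q"
  by (rule coord_linear_family(1)[OF M.chart open_U q U_domain linear_tangent tangent_differentiable[OF q] X])

lemma nabla_tangent_field:
  assumes q: "q \<in> U" and X: "coord_differentiable c X q"
  shows "nabla (\<lambda>q. tangent q (X q)) q u
    = tangent q (coord_deriv c X q u + levi_civita g c q u (X q)) + sff q u (X q)"
proof -
  have "nabla (\<lambda>q. tangent q (X q)) q u
      = nabla (\<lambda>r. tangent r (X q)) q u + tangent q (coord_deriv c X q u)"
    by (simp add: nabla_along_def
      coord_linear_family(2)[OF M.chart open_U q U_domain linear_tangent tangent_differentiable[OF q] X])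
  then show ?thesis
    by (simp add: gauss_formula(1)[OF q] linear_add[OF linear_tangent[OF q]])
qed

lemma sff_differentiable:
  assumes q: "q \<in> U"
  shows "coord_differentiable c (\<lambda>q. sff q u v) q"
proof -
  have \<Gamma>: "coord_differentiable c (\<lambda>q. levi_civita gt d (f q) (tangent q u) (tangent q v)) q"
    by (rule coord_bilinear_family(1)[OF M.chart open_U q U_domain N.levi_civita_works(1)[OF U_im]
        restrict_ambient(1)[OF q N.levi_civita_differentiable[OF U_im[OF q]]]
        tangent_differentiable[OF q] tangent_differentiable[OF q]])
  have "smooth_in c U (\<lambda>q. coord_deriv c (\<lambda>q. tangent q v) q u)"
    unfolding differential_def by (intro smooth_in_coord_deriv M.chart open_U smooth_map)
  then have D: "coord_differentiable c (\<lambda>q. coord_deriv c (\<lambda>q. tangent q v) q u) q"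
    by (rule smooth_in_differentiable) (auto intro: q U_dom)
  have "coord_differentiable c (\<lambda>q. coord_deriv c (\<lambda>q. tangent q v) q u
      + levi_civita gt d (f q) (tangent q u) (tangent q v) - tangent q (levi_civita g c q u v)) q"
    by (intro coord_add coord_minus D \<Gamma> tangent_field_differentiable q M.levi_civita_differentiable U_dom)
  then show ?thesis
    by (rule coord_cong(1)[OF M.chart open_U q U_domain, rotated]) (simp add: sff_eq nabla_along_def)
qed

end

section \<open>Totally complex immersions\<close>

text \<open>The hypothesis is \<open>\<theta> \<and> F = 0\<close>.  If \<open>\<theta> x \<noteq> 0\<close>, it expresses \<open>F\<close> through \<open>\<theta>\<close> and \<open>F x\<close>, so every vector that
  these two linear forms annihilate lies in the kernel of \<open>F\<close>; in dimension three or more such a nonzero vector exists.\<close>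

lemma one_form_vanishes:
  fixes \<theta> :: "'a::euclidean_space \<Rightarrow> real"
  assumes dim: "DIM('a) \<ge> 3" and lin: "linear \<theta>"
    and F: "bilinear F" "nondegenerate F" and skew: "\<And>u v. F u v = - F v u"
    and cyclic: "\<And>u v w. \<theta> u * F v w + \<theta> v * F w u + \<theta> w * F u v = 0"
  shows "\<theta> x = 0"
proof (rule ccontr)
  assume x: "\<theta> x \<noteq> 0"
  let ?l = "\<lambda>z. (\<theta> z, F x z)"
  have l: "linear ?l"
    using lin F(1) by (intro linearI) (simp_all add: linear_add linear_scale bilinear_radd bilinear_rmul)
  have "\<not> inj ?l"
  proof
    assume "inj ?l"
    then have "DIM('a) = dim (range ?l)"
      using dim_image_eq[OF l, of UNIV] by simp
    also have "\<dots> \<le> DIM(real \<times> real)" by (rule dim_subset_UNIV)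
    finally show False using dim by simp
  qed
  then obtain z where z: "z \<noteq> 0" "\<theta> z = 0" "F x z = 0"
    using linear_injective_0[OF l] by (auto simp: zero_prod_def)
  have "F z v = 0" for v
    using cyclic[of x v z] skew[of z x] skew[of z v] z x by simp
  then show False using F(2) z(1) unfolding nondegenerate_def by blast
qed

text \<open>A totally complex immersion of half the ambient dimension.  By the last assumption, \<open>J\<^sub>1\<close> is parallel
  along the immersion either because the dimension is large enough to force it or by hypothesis.\<close>

locale totally_complex_charts = immersion_charts c g d gt f U
  for c :: "('m::topological_space, 'a::euclidean_space) chart" and g :: "('m, 'a) bilin_field"
    and d :: "('k::topological_space, 'b::euclidean_space) chart" and gt :: "('k, 'b) bilin_field"
    and f :: "'m \<Rightarrow> 'k" and U :: "'m set" +
  fixes \<epsilon> :: real and J :: "nat \<Rightarrow> ('k, 'b) endo_field" and \<omega> :: "nat \<Rightarrow> ('k, 'b) form_field"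
    and JT :: "('m, 'a) endo_field"
  assumes eps: "\<epsilon> \<in> {-1, 1}" and dims: "DIM('b) = 2 * DIM('a)"
    and frame: "\<And>q. q \<in> U \<Longrightarrow> pq_basis (adapted_signs \<epsilon>) (\<lambda>\<alpha>. J \<alpha> d (f q))"
    and frame_differentiable: "\<And>q \<alpha> w. q \<in> U \<Longrightarrow> \<alpha> \<in> {1, 2, 3} \<Longrightarrow> coord_differentiable d (\<lambda>r. J \<alpha> d r w) (f q)"
    and frame_skew: "\<And>q \<alpha> v w. q \<in> U \<Longrightarrow> \<alpha> \<in> {1, 2, 3} \<Longrightarrow>
      gt d (f q) (J \<alpha> d (f q) v) w = - gt d (f q) v (J \<alpha> d (f q) w)"
    and JT_differentiable: "\<And>q v. q \<in> U \<Longrightarrow> coord_differentiable c (\<lambda>q. JT c q v) q"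
    and tangent_JT: "\<And>q u. q \<in> U \<Longrightarrow> differential c d f q (JT c q u) = J 1 d (f q) (differential c d f q u)"
    and totally_complex: "\<And>q u v. q \<in> U \<Longrightarrow>
      gt d (f q) (J 2 d (f q) (differential c d f q u)) (differential c d f q v) = 0"
    and nabla_J1: "\<And>q u v. q \<in> U \<Longrightarrow> nabla_endo gt d (J 1) (f q) u v
      = - \<omega> 3 d (f q) u *\<^sub>R J 2 d (f q) v - (\<epsilon> * \<omega> 2 d (f q) u) *\<^sub>R J 3 d (f q) v"
    and nabla_J2: "\<And>q u v. q \<in> U \<Longrightarrow> nabla_endo gt d (J 2) (f q) u v
      = (\<epsilon> * \<omega> 1 d (f q) u) *\<^sub>R J 3 d (f q) v + (\<epsilon> * \<omega> 3 d (f q) u) *\<^sub>R J 1 d (f q) v"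
    and nabla_J3: "\<And>q u v. q \<in> U \<Longrightarrow> nabla_endo gt d (J 3) (f q) u v
      = - (\<epsilon> * \<omega> 2 d (f q) u) *\<^sub>R J 1 d (f q) v + \<omega> 1 d (f q) u *\<^sub>R J 2 d (f q) v"
    and linear_form: "\<And>q \<alpha>. q \<in> U \<Longrightarrow> \<alpha> \<in> {1, 2, 3} \<Longrightarrow> linear (\<omega> \<alpha> d (f q))"
    and parallel_or_large: "DIM('a) \<ge> 3 \<or>
      (\<forall>q\<in>U. \<forall>u w. nabla_endo gt d (J 1) (f q) (differential c d f q u) w = 0)"
begin

\<comment> \<open>The indices of the frame are to stay the numerals 1, 2, 3.\<close>
declare One_nat_def [simp del]

abbreviation frame_at :: "nat \<Rightarrow> 'm \<Rightarrow> 'b \<Rightarrow> 'b" where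
  "frame_at \<alpha> q \<equiv> J \<alpha> d (f q)"

abbreviation shape :: "'m \<Rightarrow> 'a \<Rightarrow> 'a \<Rightarrow> 'a" where
  "shape \<equiv> shape_tensor c d f gt J"

lemma linear_frame: "q \<in> U \<Longrightarrow> \<alpha> \<in> {1, 2, 3} \<Longrightarrow> linear (frame_at \<alpha> q)"
  using frame unfolding pq_basis_def by blast

lemmas linear_frames = linear_frame[of _ 1, simplified] linear_frame[of _ 2, simplified]
  linear_frame[of _ 3, simplified]

lemma frame_products:
  assumes q: "q \<in> U"
  shows "frame_at 1 q (frame_at 1 q v) = \<epsilon> *\<^sub>R v" and "frame_at 2 q (frame_at 2 q v) = v"
    and "frame_at 3 q v = frame_at 1 q (frame_at 2 q v)"
    and "frame_at 2 q (frame_at 1 q v) = - frame_at 1 q (frame_at 2 q v)"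
proof -
  note b = frame[OF q, unfolded pq_basis_def]
  note square = b[THEN conjunct2, THEN conjunct1, rule_format, THEN conjunct2, rule_format]
    and anticommute = b[THEN conjunct2, THEN conjunct2, THEN conjunct1, rule_format]
  show "frame_at 1 q (frame_at 1 q v) = \<epsilon> *\<^sub>R v"
    using square[of 1 v] by (simp add: adapted_signs_def)
  show "frame_at 2 q (frame_at 2 q v) = v"
    using square[of 2 v] by (simp add: adapted_signs_def)
  show "frame_at 3 q v = frame_at 1 q (frame_at 2 q v)"
    by (rule b[THEN conjunct2, THEN conjunct2, THEN conjunct2, rule_format])
  show "frame_at 2 q (frame_at 1 q v) = - frame_at 1 q (frame_at 2 q v)"
    by (rule anticommute) simp_all
qed

lemma tangent_inject: "q \<in> U \<Longrightarrow> tangent q u = tangent q v \<longleftrightarrow> u = v"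
  using inj_differential by (auto dest: injD)

lemma normal_J2_tangent: "q \<in> U \<Longrightarrow> normal_at q (frame_at 2 q (tangent q u))"
  by (simp add: normal_at_def totally_complex)

lemma normal_J1:
  assumes q: "q \<in> U" and n: "normal_at q n" shows "normal_at q (frame_at 1 q n)"
  using n unfolding normal_at_def
  by (simp add: frame_skew[OF q, of 1, simplified] tangent_JT[OF q, symmetric])

lemma normal_J3_tangent: "q \<in> U \<Longrightarrow> normal_at q (frame_at 3 q (tangent q u))"
  using normal_J1[OF _ normal_J2_tangent] by (simp add: frame_products(3))

text \<open>Here the dimension enters: tangent vectors and their images under \<open>J\<^sub>2\<close> already span the ambient space, so every
  normal vector is \<open>J\<^sub>2\<close> of a tangent one.\<close>

lemma J2_normal_tangent:
  assumes q: "q \<in> U" and n: "normal_at q n"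
  obtains t where "frame_at 2 q n = tangent q t"
proof -
  let ?l = "\<lambda>(u, v). tangent q u + frame_at 2 q (tangent q v)"
  note L = linear_tangent[OF q] linear_frames(2)[OF q]
  have l: "linear ?l"
    by (rule linearI) (auto simp: L[THEN linear_add] L[THEN linear_scale] scaleR_add_right)
  have "inj ?l"
  proof (rule linear_injective_0[OF l, THEN iffD2], clarsimp simp: zero_prod_def)
    fix u v assume eq: "tangent q u + frame_at 2 q (tangent q v) = 0"
    have 0: "normal_at q 0" by (simp add: normal_at_def bilinear_lzero[OF ambient_bilinear[OF q]])
    have "tangent q u + frame_at 2 q (tangent q v) = tangent q 0 + 0"
      using eq by (simp add: linear_0[OF L(1)])
    from decomposition_unique[OF q this normal_J2_tangent[OF q] 0]
    have "u = 0" and v: "frame_at 2 q (tangent q v) = 0" by auto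
    have "tangent q v = frame_at 2 q (frame_at 2 q (tangent q v))" by (simp add: frame_products(2)[OF q])
    also have "\<dots> = tangent q 0" by (simp only: v linear_0[OF L(1)] linear_0[OF L(2)])
    finally have "v = 0" by (simp add: tangent_inject[OF q])
    with \<open>u = 0\<close> show "u = 0 \<and> v = 0" by simp
  qed
  then have "surj ?l"
    using linear_injective_imp_surjective[OF l] dims by simp
  then obtain u v where "n = tangent q u + frame_at 2 q (tangent q v)"
    by (metis (no_types, lifting) case_prod_conv surj_pair surjD)
  moreover have "tangent q 0 + n = n" by (simp add: linear_0[OF L(1)])
  ultimately have "tangent q 0 + n = tangent q u + frame_at 2 q (tangent q v)" by simp
  from decomposition_unique(2)[OF q this n normal_J2_tangent[OF q]]
  have "frame_at 2 q n = tangent q v" by (simp add: frame_products(2)[OF q])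
  then show thesis by (rule that)
qed

lemma tangent_shape:
  assumes q: "q \<in> U"
  shows "tangent q (shape q u v) = frame_at 2 q (sff q u v)"
proof -
  obtain t where t: "frame_at 2 q (sff q u v) = tangent q t"
    by (rule J2_normal_tangent[OF q gauss_formula(2)[OF q]])
  show ?thesis
    unfolding shape_tensor_def t by (rule theI[of _ t]) (simp_all add: tangent_inject[OF q])
qed

text \<open>The derivative of the identity \<open>g(J\<^sub>a Y, Z) = 0\<close>, where \<open>J\<^sub>a\<close> is moved to the other side by skew-symmetry.\<close>

lemma derivative_of_normality:
  assumes q: "q \<in> U" and \<alpha>: "\<alpha> \<in> {1, 2, 3}"
    and normal: "\<And>q u. q \<in> U \<Longrightarrow> normal_at q (frame_at \<alpha> q (tangent q u))"
  shows "gt d (f q) (nabla_endo gt d (J \<alpha>) (f q) (tangent q u) (tangent q v)) (tangent q w)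
    = gt d (f q) (frame_at \<alpha> q (nabla (\<lambda>q. tangent q w) q u)) (tangent q v)
      - gt d (f q) (frame_at \<alpha> q (nabla (\<lambda>q. tangent q v) q u)) (tangent q w)"
proof -
  note E = nabla_endo[of q "J \<alpha>", OF q linear_frame[OF _ \<alpha>] frame_differentiable[OF q \<alpha>]
    tangent_differentiable[OF q]]
  have "coord_deriv c (\<lambda>q. gt d (f q) (frame_at \<alpha> q (tangent q v)) (tangent q w)) q u
      = coord_deriv c (\<lambda>q. 0) q u"
    by (rule fun_cong[OF coord_cong(2)[OF M.chart open_U q U_domain]])
      (use normal in \<open>auto simp: normal_at_def\<close>)
  then have "gt d (f q) (nabla (\<lambda>q. frame_at \<alpha> q (tangent q v)) q u) (tangent q w)
      + gt d (f q) (frame_at \<alpha> q (tangent q v)) (nabla (\<lambda>q. tangent q w) q u) = 0"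
    by (simp add: nabla_metric[OF q E(1) tangent_differentiable[OF q]])
  then show ?thesis
    using ambient_commute[OF q, of "tangent q v" "frame_at \<alpha> q (nabla (\<lambda>q. tangent q w) q u)"]
    by (simp add: E(2) bilinear_ladd[OF ambient_bilinear[OF q]] frame_skew[OF q \<alpha>, of "tangent q v"])
qed

text \<open>The right-hand side of the preceding identity is the antisymmetrisation in the last two arguments of a trilinear form
  that is symmetric in the first two, so its cyclic sum vanishes.\<close>

lemma frame_form_vanishes:
  assumes q: "q \<in> U" and \<alpha>: "\<alpha> \<in> {1, 2, 3}" and dim: "DIM('a) \<ge> 3"
    and normal: "\<And>q u. q \<in> U \<Longrightarrow> normal_at q (frame_at \<alpha> q (tangent q u))"
    and lin: "linear \<theta>"
    and \<theta>: "\<And>u v w. gt d (f q) (nabla_endo gt d (J \<alpha>) (f q) (tangent q u) (tangent q v)) (tangent q w)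
      = \<theta> u * gt d (f q) (frame_at 1 q (tangent q v)) (tangent q w)"
  shows "\<theta> u = 0"
proof -
  define F where "F = (\<lambda>v w. gt d (f q) (frame_at 1 q (tangent q v)) (tangent q w))"
  define T where "T = (\<lambda>u v w. gt d (f q) (frame_at \<alpha> q (nabla (\<lambda>q. tangent q v) q u)) (tangent q w))"
  have T: "T u v w = T v u w" for u v w
    by (simp add: T_def nabla_tangent_commute[OF q, of v u])
  have diff: "\<theta> u * F v w = T u w v - T u v w" for u v w
    using \<theta>[of u v w] derivative_of_normality[OF q \<alpha> normal, of u v w] by (simp add: F_def T_def)
  show ?thesis
  proof (rule one_form_vanishes[OF dim lin, of F])
    note L = linear_tangent[OF q] linear_frames(1)[OF q]
    note bil = ambient_bilinear[OF q]
    show "bilinear F"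
      unfolding bilinear_def F_def
      by (auto intro!: linearI simp: L[THEN linear_add] L[THEN linear_scale] bilinear_ladd[OF bil]
        bilinear_radd[OF bil] bilinear_lmul[OF bil] bilinear_rmul[OF bil])
    show "F v w = - F w v" for v w
      using frame_skew[OF q, of 1 "tangent q v"] ambient_commute[OF q, of "tangent q v"]
      by (simp add: F_def)
    show "nondegenerate F"
      unfolding nondegenerate_def
    proof (intro allI impI)
      fix v assume "\<forall>w. F v w = 0"
      then have "normal_at q (tangent q (JT c q v))"
        by (simp add: F_def normal_at_def tangent_JT[OF q])
      then have "JT c q v = 0" by (rule tangent_normal_zero[OF q])
      then have "frame_at 1 q (tangent q v) = 0" using tangent_JT[OF q, of v] linear_0[OF L(1)] by simp
      then have "\<epsilon> *\<^sub>R tangent q v = 0" using frame_products(1)[OF q, of "tangent q v"] linear_0[OF L(2)] by simp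
      then show "v = 0" using eps tangent_inject[OF q, of v 0] linear_0[OF L(1)] by auto
    qed
    show "\<theta> u * F v w + \<theta> v * F w u + \<theta> w * F u v = 0" for u v w
      using T[of u w v] T[of u v w] T[of v w u] by (simp add: diff)
  qed
qed

text \<open>If \<open>\<omega>\<^sub>3 J\<^sub>2 + \<epsilon> \<omega>\<^sub>2 J\<^sub>3 = 0\<close>, both coefficients vanish, since \<open>J\<^sub>2\<close> and \<open>J\<^sub>3 = J\<^sub>1 J\<^sub>2\<close> are linearly
  independent.\<close>

lemma parallel_forms_vanish:
  assumes q: "q \<in> U" and parallel: "\<And>w. nabla_endo gt d (J 1) (f q) x w = 0"
  shows "\<omega> 2 d (f q) x = 0" and "\<omega> 3 d (f q) x = 0"
proof -
  define a b where "a = \<omega> 3 d (f q) x" and "b = \<epsilon> * \<omega> 2 d (f q) x"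
  note P = frame_products[OF q]
  note L = linear_frames[OF q]
  \<comment> \<open>Evaluate at \<open>J\<^sub>2 w\<close>; conjugating with \<open>J\<^sub>2\<close> below changes the sign of the \<open>J\<^sub>1\<close> term.\<close>
  have eq: "a *\<^sub>R w + b *\<^sub>R frame_at 1 q w = 0" for w
  proof -
    have "- (a *\<^sub>R w) - b *\<^sub>R frame_at 1 q w = 0"
      using parallel[of "frame_at 2 q w"] nabla_J1[OF q, of x "frame_at 2 q w"]
      by (simp add: P a_def b_def)
    moreover have "a *\<^sub>R w + b *\<^sub>R frame_at 1 q w = - (- (a *\<^sub>R w) - b *\<^sub>R frame_at 1 q w)" by simp
    ultimately show ?thesis by (simp only: minus_zero)
  qed
  obtain e :: 'b where e: "e \<noteq> 0" using nonempty_Basis nonzero_Basis by blast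
  have "frame_at 2 q (a *\<^sub>R frame_at 2 q e + b *\<^sub>R frame_at 1 q (frame_at 2 q e)) = a *\<^sub>R e - b *\<^sub>R frame_at 1 q e"
    by (simp add: linear_add[OF L(2)] linear_scale[OF L(2)] P)
  then have "a *\<^sub>R e - b *\<^sub>R frame_at 1 q e = 0" by (simp add: eq linear_0[OF L(2)])
  then have "a *\<^sub>R e + a *\<^sub>R e = 0" using eq[of e] by (simp add: algebra_simps)
  then have "a = 0" using e by (simp flip: scaleR_add_left)
  with eq[of "frame_at 1 q e"] e eps have "b = 0" by (auto simp: P)
  show "\<omega> 3 d (f q) x = 0" "\<omega> 2 d (f q) x = 0" using \<open>a = 0\<close> \<open>b = 0\<close> eps by (auto simp: a_def b_def)
qed

lemma forms_vanish:
  assumes q: "q \<in> U"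
  shows "\<omega> 2 d (f q) (tangent q u) = 0" and "\<omega> 3 d (f q) (tangent q u) = 0"
proof -
  have "\<omega> 2 d (f q) (tangent q u) = 0 \<and> \<omega> 3 d (f q) (tangent q u) = 0"
  proof (cases "DIM('a) \<ge> 3")
    case True
    note n2 = normal_J2_tangent[unfolded normal_at_def, rule_format]
    note n3 = normal_J3_tangent[unfolded normal_at_def, rule_format]
    note bil = ambient_bilinear[OF q]
    have lin: "linear (\<lambda>u. r * \<omega> \<alpha> d (f q) (tangent q u))" if "\<alpha> \<in> {1, 2, 3}" for r \<alpha>
      using linear_tangent[OF q] linear_form[OF q that]
      by (auto intro!: linearI simp: linear_add linear_scale algebra_simps)
    have "\<epsilon> * \<omega> 3 d (f q) (tangent q u) = 0"
      by (rule frame_form_vanishes[OF q _ True normal_J2_tangent lin])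
        (simp_all add: nabla_J2[OF q] n3[OF q] bilinear_ladd[OF bil] bilinear_lmul[OF bil])
    moreover have "- \<epsilon> * \<omega> 2 d (f q) (tangent q u) = 0"
      by (rule frame_form_vanishes[OF q _ True normal_J3_tangent lin])
        (simp_all add: nabla_J3[OF q] n2[OF q] bilinear_ladd[OF bil] bilinear_lmul[OF bil] bilinear_lsub[OF bil])
    ultimately show ?thesis using eps by auto
  next
    case False
    then show ?thesis using parallel_or_large parallel_forms_vanish[OF q] q by blast
  qed
  then show "\<omega> 2 d (f q) (tangent q u) = 0" and "\<omega> 3 d (f q) (tangent q u) = 0" by simp_all
qed

text \<open>The derivative of \<open>J\<^sub>1 Y = \<J>Y\<close>, compared in its normal part; \<open>J\<^sub>1\<close> is parallel in tangent directions and
  preserves tangent and normal vectors.\<close>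

lemma sff_JT:
  assumes q: "q \<in> U"
  shows "sff q u (JT c q v) = frame_at 1 q (sff q u v)"
proof -
  note E = nabla_endo[of q "J 1", OF q linear_frames(1) frame_differentiable[OF q] tangent_differentiable[OF q], simplified]
  have "tangent q (coord_deriv c (\<lambda>q. JT c q v) q u + levi_civita g c q u (JT c q v)) + sff q u (JT c q v)
      = nabla (\<lambda>q. tangent q (JT c q v)) q u"
    by (rule nabla_tangent_field[OF q JT_differentiable[OF q], symmetric])
  also have "\<dots> = nabla (\<lambda>q. frame_at 1 q (tangent q v)) q u"
    by (rule nabla_cong[OF q]) (simp_all add: tangent_JT E(1))
  also have "\<dots> = frame_at 1 q (nabla (\<lambda>q. tangent q v) q u)"
    using E(2)[of v u] nabla_J1[OF q] forms_vanish[OF q] by simp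
  also have "\<dots> = tangent q (JT c q (levi_civita g c q u v)) + frame_at 1 q (sff q u v)"
    using linear_add[OF linear_frames(1)[OF q]]
    by (simp add: gauss_formula(1)[OF q] tangent_JT[OF q])
  finally show ?thesis
    by (rule decomposition_unique(2)[OF q _ gauss_formula(2)[OF q] normal_J1[OF q gauss_formula(2)[OF q]]])
qed

text \<open>In the product with a tangent vector, \<open>h(X, Y)\<close> may be replaced by the full ambient derivative, since \<open>J\<^sub>2\<close>
  makes its tangential part normal.\<close>

lemma metric_shape:
  assumes q: "q \<in> U"
  shows "g c q (shape q u v) w = gt d (f q) (frame_at 2 q (nabla (\<lambda>q. tangent q v) q u)) (tangent q w)"
  by (simp add: induced[OF q] tangent_shape[OF q] gauss_formula(1)[OF q] totally_complex[OF q]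
    linear_add[OF linear_frames(2)[OF q]] bilinear_ladd[OF ambient_bilinear[OF q]])

lemma shape_selfadjoint:
  assumes q: "q \<in> U"
  shows "g c q (shape q u v) w = g c q v (shape q u w)"
proof -
  have "gt d (f q) (nabla_endo gt d (J 2) (f q) (tangent q u) (tangent q v)) (tangent q w) = 0"
    using normal_J3_tangent[OF q, of v]
    by (simp add: nabla_J2[OF q] forms_vanish[OF q] bilinear_lmul[OF ambient_bilinear[OF q]] normal_at_def)
  then show ?thesis
    using derivative_of_normality[OF q _ normal_J2_tangent, of u v w]
      M.metric_commute[OF U_dom[OF q], of v]
    by (simp add: metric_shape[OF q])
qed

lemma shape_commute: "q \<in> U \<Longrightarrow> shape q u v = shape q v u"
  by (simp add: shape_tensor_def sff_commute[of q u v])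

lemma linear_shape: 
  assumes q: "q \<in> U" shows "linear (shape q u)"
proof (rule linearI)
  note L = linear_tangent[OF q] linear_frames(2)[OF q]
  fix v w :: 'a and r :: real
  have "tangent q (shape q u (v + w)) = tangent q (shape q u v + shape q u w)"
    by (simp add: tangent_shape[OF q] L[THEN linear_add] bilinear_radd[OF bilinear_sff[OF q]])
  then show "shape q u (v + w) = shape q u v + shape q u w" by (simp add: tangent_inject[OF q])
  have "tangent q (shape q u (r *\<^sub>R v)) = tangent q (r *\<^sub>R shape q u v)"
    by (simp add: tangent_shape[OF q] L[THEN linear_scale] bilinear_rmul[OF bilinear_sff[OF q]])
  then show "shape q u (r *\<^sub>R v) = r *\<^sub>R shape q u v" by (simp add: tangent_inject[OF q])
qed

lemma shape_in_prolongation: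
  assumes q: "q \<in> U"
  shows "shape q \<in> S_prolongation (g c q) (JT c q)"
proof -
  have "shape q u (JT c q v) + JT c q (shape q u v) = 0" for u v
  proof -
    have "tangent q (shape q u (JT c q v) + JT c q (shape q u v)) = tangent q 0"
      using linear_0[OF linear_tangent[OF q]]
      by (simp add: linear_add[OF linear_tangent[OF q]] tangent_shape[OF q] tangent_JT[OF q]
        sff_JT[OF q] frame_products(4)[OF q])
    then show ?thesis by (simp add: tangent_inject[OF q])
  qed
  moreover have "linear (\<lambda>u. shape q u v)" for v
  proof -
    have "shape q v = (\<lambda>u. shape q u v)" by (rule ext) (rule shape_commute[OF q])
    then show ?thesis using linear_shape[OF q, of v] by simp
  qed
  ultimately show ?thesis
    unfolding S_prolongation_def S_space_def
    using linear_shape[OF q] shape_selfadjoint[OF q] shape_commute[OF q] by blast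
qed

lemma shape_differentiable:
  assumes q: "q \<in> U"
  shows "coord_differentiable c (\<lambda>q. shape q v w) q"
proof (rule coord_nondegenerate_solution[OF M.chart open_U q U_domain M.bilinear_metric[OF U_dom]
      M.nondegenerate_metric[OF U_dom[OF q]] M.metric_differentiable[OF U_dom[OF q]]])
  fix e
  have "coord_differentiable c (\<lambda>q. frame_at 2 q (sff q v w)) q"
    by (rule nabla_endo(1)[of q "J 2", OF q linear_frames(2) frame_differentiable[OF q] sff_differentiable[OF q]])
      simp_all
  then have "coord_differentiable c (\<lambda>q. gt d (f q) (frame_at 2 q (sff q v w)) (tangent q e)) q"
    by (intro coord_bilinear_family(1)[OF M.chart open_U q U_domain ambient_bilinear
        restrict_ambient(1)[OF q N.metric_differentiable[OF U_im[OF q]]]] tangent_differentiable[OF q])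
  then show "coord_differentiable c (\<lambda>q. g c q (shape q v w) e) q"
    by (rule coord_cong(1)[OF M.chart open_U q U_domain, rotated]) (simp add: induced tangent_shape)
qed

text \<open>Up to the same correction terms for \<open>v\<close> and \<open>w\<close>, both sides are the tangential part of the derivative of
  \<open>J\<^sub>2 h(v, w)\<close>, computed once as the derivative of the tangent field \<open>C\<^sub>v w\<close> and once by the product rule.\<close>

lemma nabla_shape_formula:
  assumes q: "q \<in> U"
  shows "tangent q (nabla_shape c d f gt g J q u v w)
    = frame_at 2 q (nabla_h c d f gt g q u v w)
      + (\<epsilon> * \<omega> 1 d (f q) (tangent q u)) *\<^sub>R tangent q (JT c q (shape q v w))"
proof -
  \<comment> \<open>\<open>X\<close> is the derivative of the vector field \<open>C\<^sub>v w\<close>; the terms with derivatives of \<open>v\<close> and \<open>w\<close> agree on both sides.\<close>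
  note LT = linear_tangent[OF q] and L2 = linear_frames(2)[OF q]
  define X where "X = coord_deriv c (\<lambda>q. shape q v w) q u + levi_civita g c q u (shape q v w)"
  define y where "y = (\<epsilon> * \<omega> 1 d (f q) (tangent q u)) *\<^sub>R tangent q (JT c q (shape q v w))"
  obtain t n where tn: "nabla (\<lambda>q. sff q v w) q u = tangent q t + n" "normal_at q n"
    "normal_part c d f gt q (nabla (\<lambda>q. sff q v w) q u) = n"
    by (rule decomposition_exists[OF q])
  have conn: "normal_connection c d f gt (\<lambda>q. sff q v w) q u = n"
    using tn(3) by (simp add: normal_connection_def)
  obtain s where s: "frame_at 2 q n = tangent q s" by (rule J2_normal_tangent[OF q tn(2)])
  note E = nabla_endo[of q "J 2", OF q linear_frames(2) frame_differentiable[OF q] sff_differentiable[OF q], simplified]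
  have "tangent q X + sff q u (shape q v w) = nabla (\<lambda>q. tangent q (shape q v w)) q u"
    unfolding X_def by (rule nabla_tangent_field[OF q shape_differentiable[OF q], symmetric])
  also have "\<dots> = nabla (\<lambda>q. frame_at 2 q (sff q v w)) q u"
    by (rule nabla_cong[OF q]) (simp_all add: tangent_shape E(1))
  also have "\<dots> = y + frame_at 2 q (tangent q t + n)"
    by (simp add: E(2) nabla_J2[OF q] forms_vanish[OF q] frame_products(3)[OF q] y_def tn(1)
      tangent_JT[OF q] tangent_shape[OF q])
  also have "\<dots> = tangent q ((\<epsilon> * \<omega> 1 d (f q) (tangent q u)) *\<^sub>R JT c q (shape q v w) + s)
      + frame_at 2 q (tangent q t)"
    by (simp add: y_def linear_add[OF LT] linear_add[OF L2] linear_scale[OF LT] s)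
  finally have "X = (\<epsilon> * \<omega> 1 d (f q) (tangent q u)) *\<^sub>R JT c q (shape q v w) + s"
    by (rule decomposition_unique(1)[OF q _ gauss_formula(2)[OF q] normal_J2_tangent[OF q]])
  then have "tangent q X = y + frame_at 2 q n"
    by (simp add: y_def linear_add[OF LT] linear_scale[OF LT] s)
  then show ?thesis
    unfolding y_def[symmetric] nabla_shape_def nabla_h_def conn
    by (simp add: X_def[symmetric] linear_diff[OF LT] linear_diff[OF L2] tangent_shape[OF q])
qed

end

section \<open>From atlases to a pair of charts\<close>

lemma chart_metric_of_atlas:
  assumes "smooth_atlas A" and "pseudo_riemannian A g" and "c \<in> A"
  shows "chart_metric c g"
proof
  show "is_chart c" using assms(1,3) by (simp add: smooth_atlas_def)
  note metric = assms(2)[unfolded pseudo_riemannian_def]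
  show "bilinear (g c q)" "g c q u v = g c q v u" "nondegenerate (g c q)" if "q \<in> fst c" for q u v
    using metric[THEN conjunct1, rule_format, OF assms(3) that] by simp_all
  show "smooth_in c UNIV (\<lambda>q. g c q u v)" for u v
    using metric[THEN conjunct2, THEN conjunct1, rule_format, OF assms(3)] .
qed

lemma mem_endo_span:
  assumes "\<alpha> \<in> {1, 2, 3}" shows "J \<alpha> \<in> endo_span J"
proof -
  have eq: "J \<alpha> = (\<lambda>v. \<Sum>\<beta>\<in>{1, 2, 3}. (if \<beta> = \<alpha> then 1 else 0) *\<^sub>R J \<beta> v)"
    using assms by (auto simp: if_distrib[of "\<lambda>r. r *\<^sub>R _"] cong: if_cong)
  show ?thesis
    unfolding endo_span_def by (rule CollectI, rule exI[of _ "\<lambda>\<beta>. if \<beta> = \<alpha> then 1 else 0"]) (rule eq)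
qed

theorem corollary5p2:
  fixes \<epsilon> :: real and n :: nat
    and B :: "('k::{t2_space, second_countable_topology}, 'b::euclidean_space) chart set"
    and Q :: "('k, 'b) endo_subbundle" and gt :: "('k, 'b) bilin_field"
    and A :: "('m::{t2_space, second_countable_topology}, 'a::euclidean_space) chart set"
    and f :: "'m \<Rightarrow> 'k" and g :: "('m, 'a) bilin_field"
    and Je :: "('k, 'b) chart \<Rightarrow> 'm \<Rightarrow> 'b \<Rightarrow> 'b" and JT :: "('m, 'a) endo_field"
    and N :: "'k set" and J :: "nat \<Rightarrow> ('k, 'b) endo_field" and \<omega> :: "nat \<Rightarrow> ('k, 'b) form_field"
  assumes eps: "\<epsilon> \<in> {-1, 1}"
    and ambient: "para_quaternionic_kaehler n B Q gt"
    and nu: "\<forall>d\<in>B. \<forall>q\<in>fst d. reduced_scal n gt d q \<noteq> 0"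
    and dim: "DIM('a) = 2 * n"
    and kaehler: "eps_kaehler_submanifold \<epsilon> A B f Q gt g Je JT"
    and surface_case: "n = 1 \<longrightarrow> parallel_along A B f gt Je"
    and basis: "adapted_basis \<epsilon> B N f Q Je J"
    and forms: "connection_forms B N gt (adapted_signs \<epsilon>) J \<omega>"
    and complex: "totally_complex A B N f gt J"
  shows "\<forall>c\<in>A. \<forall>d\<in>B. \<forall>p\<in>fst c \<inter> f -` (fst d \<inter> N).
      (\<forall>u v. differential c d f p (shape_tensor c d f gt J p u v)
             = J 2 d (f p) (second_fundamental_form c d f gt p u v)) \<and>
      shape_tensor c d f gt J p \<in> S_prolongation (g c p) (JT c p) \<and>
      (\<forall>u v w. differential c d f p (nabla_shape c d f gt g J p u v w)
             = J 2 d (f p) (nabla_h c d f gt g p u v w)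
               + (\<epsilon> * \<omega> 1 d (f p) (differential c d f p u)) *\<^sub>R
                   differential c d f p (JT c p (shape_tensor c d f gt J p v w)))"
proof (intro ballI)
  fix c d p
  assume c: "c \<in> A" and d: "d \<in> B" and p: "p \<in> fst c \<inter> f -` (fst d \<inter> N)"
  define U where "U = fst c \<inter> f -` (fst d \<inter> N)"
  have q: "q \<in> fst c" "f q \<in> fst d" "f q \<in> N" "q \<in> fst c \<inter> f -` fst d" "f q \<in> fst d \<inter> N"
    if "q \<in> U" for q using that by (auto simp: U_def)

  note ambient' = ambient[unfolded para_quaternionic_kaehler_def]
  have hermitian: "almost_eps_hermitian_submanifold \<epsilon> A B f Q gt g Je JT"
    using kaehler by (simp add: eps_kaehler_submanifold_def)
  note hermitian' = hermitian[unfolded almost_eps_hermitian_submanifold_def]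
  have immersed: "immersed_submanifold A B f" and induced: "induced_metric A B f gt g"
    and riem: "pseudo_riemannian A g" and JT: "endo_field_on A UNIV JT"
    using hermitian' by blast+
  have Je: "differential c d f q (JT c q u) = Je d q (differential c d f q u)" if "q \<in> U" for q u
    using hermitian' c d q(4)[OF that] by blast
  have J1: "J 1 d (f q) = Je d q" if "q \<in> U" for q
    using basis d q(5)[OF that] unfolding adapted_basis_def by blast

  interpret M: chart_metric c g
    using immersed riem c by (intro chart_metric_of_atlas) (auto simp: immersed_submanifold_def)
  interpret N: chart_metric d gt
    using ambient' d by (intro chart_metric_of_atlas) auto
  have N: "open N" and endo: "\<And>\<alpha>. \<alpha> \<in> {1, 2, 3} \<Longrightarrow> endo_field_on B N (J \<alpha>)"
    and at: "\<And>r. r \<in> fst d \<inter> N \<Longrightarrow> pq_basis (adapted_signs \<epsilon>) (\<lambda>\<alpha>. J \<alpha> d r) \<and> Q d r = endo_span (\<lambda>\<alpha>. J \<alpha> d r)"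
    using basis d unfolding adapted_basis_def pq_frame_on_def by blast+
  interpret immersion_charts c g d gt f U
  proof
    have "continuous_on UNIV f" using immersed by (simp add: immersed_submanifold_def)
    then show "open U"
      unfolding U_def by (intro open_Int M.open_domain open_vimage N.open_domain N)
    have "smooth_in c (f -` fst d) (snd d \<circ> f)"
      using immersed c d by (simp add: immersed_submanifold_def)
    then show "smooth_in c U (snd d \<circ> f)"
      by (rule smooth_in_subset) (auto simp: U_def)
    show "inj (differential c d f q)" if "q \<in> U" for q
      using immersed c d q(4)[OF that] unfolding immersed_submanifold_def by blast
    show "g c q u v = gt d (f q) (differential c d f q u) (differential c d f q v)" if "q \<in> U" for q u v
      using induced c d q(4)[OF that] unfolding induced_metric_def by blast
  qed (auto simp: U_def)

  have frame_differentiable: "coord_differentiable d (\<lambda>r. J \<alpha> d r w) (f q)"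
    if "q \<in> U" "\<alpha> \<in> {1, 2, 3}" for q \<alpha> w
  proof (rule smooth_in_differentiable)
    show "smooth_in d N (\<lambda>r. J \<alpha> d r w)"
      using endo[OF that(2)] d unfolding endo_field_on_def by blast
  qed (use q[OF that(1)] in auto)
  note connection = forms[unfolded connection_forms_def]
  have covariant: "nabla_endo gt d (J \<alpha>) (f q) u v
      = - (adapted_signs \<epsilon> \<beta> * \<omega> \<gamma> d (f q) u) *\<^sub>R J \<beta> d (f q) v
        + (adapted_signs \<epsilon> \<gamma> * \<omega> \<beta> d (f q) u) *\<^sub>R J \<gamma> d (f q) v"
    if "q \<in> U" "(\<alpha>, \<beta>, \<gamma>) \<in> {(1, 2, 3), (2, 3, 1), (3, 1, 2)}" for q \<alpha> \<beta> \<gamma> u v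
    using connection[THEN conjunct2, THEN bspec, OF that(2)] d q(5)[OF that(1)] by blast
  \<comment> \<open>Along the submanifold the given section is \<open>J\<^sub>1\<close>, so the chain rule turns its derivative into that of \<open>J\<^sub>1\<close>.\<close>
  have parallel: "nabla_endo gt d (J 1) (f q) (tangent q u) w = 0" if "n = 1" "q \<in> U" for q u w
  proof -
    note D = restrict_ambient[OF that(2) frame_differentiable[OF that(2), of 1 w, simplified]]
    have "coord_deriv c (\<lambda>q. Je d q w) q u = coord_deriv c (\<lambda>q. J 1 d (f q) w) q u"
      by (rule fun_cong[OF coord_cong(2)[OF M.chart open_U that(2) U_domain]])
        (use J1 D(1) in simp_all)
    moreover have "nabla (\<lambda>q. Je d q w) q u
        = Je d q (levi_civita gt d (f q) (tangent q u) w)"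
      using surface_case that(1) c d q(4)[OF that(2)] unfolding parallel_along_def by blast
    ultimately show ?thesis
      using D(2) J1[OF that(2)] by (simp add: nabla_endo_def nabla_along_def algebra_simps)
  qed

  interpret totally_complex_charts c g d gt f U \<epsilon> J \<omega> JT
  proof (rule totally_complex_charts.intro[OF immersion_charts_axioms], rule totally_complex_charts_axioms.intro)
    fix q assume U: "q \<in> U"
    show "pq_basis (adapted_signs \<epsilon>) (\<lambda>\<alpha>. J \<alpha> d (f q))" using at q(5)[OF U] by blast
    show "coord_differentiable c (\<lambda>q. JT c q v) q" for v
    proof (rule smooth_in_differentiable)
      show "smooth_in c UNIV (\<lambda>q. JT c q v)" using JT c unfolding endo_field_on_def by blast
    qed (use q[OF U] in auto)
    show "tangent q (JT c q u) = J 1 d (f q) (tangent q u)" for u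
      using Je[OF U] J1[OF U] by simp
    show "gt d (f q) (J 2 d (f q) (tangent q u)) (tangent q v) = 0" for u v
      using complex c d U unfolding totally_complex_def U_def by blast
    show "nabla_endo gt d (J 1) (f q) u v
        = - \<omega> 3 d (f q) u *\<^sub>R J 2 d (f q) v - (\<epsilon> * \<omega> 2 d (f q) u) *\<^sub>R J 3 d (f q) v" for u v
      by (subst covariant[OF U, of 1 2 3]) (simp_all add: adapted_signs_def)
    show "nabla_endo gt d (J 2) (f q) u v
        = (\<epsilon> * \<omega> 1 d (f q) u) *\<^sub>R J 3 d (f q) v + (\<epsilon> * \<omega> 3 d (f q) u) *\<^sub>R J 1 d (f q) v" for u v
      by (subst covariant[OF U, of 2 3 1]) (simp_all add: adapted_signs_def)
    show "nabla_endo gt d (J 3) (f q) u v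
        = - (\<epsilon> * \<omega> 2 d (f q) u) *\<^sub>R J 1 d (f q) v + \<omega> 1 d (f q) u *\<^sub>R J 2 d (f q) v" for u v
      by (subst covariant[OF U, of 3 1 2]) (simp_all add: adapted_signs_def)
    fix \<alpha> :: nat assume \<alpha>: "\<alpha> \<in> {1, 2, 3}"
    show "coord_differentiable d (\<lambda>r. J \<alpha> d r w) (f q)" for w
      by (rule frame_differentiable[OF U \<alpha>])
    have "J \<alpha> d (f q) \<in> Q d (f q)"
      using at[OF q(5)[OF U]] mem_endo_span[OF \<alpha>, of "\<lambda>\<alpha>. J \<alpha> d (f q)"] by simp
    moreover have "\<forall>d\<in>B. \<forall>r\<in>fst d. \<forall>S\<in>Q d r. \<forall>u v. gt d r (S u) v = - gt d r u (S v)"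
      using ambient' by blast
    ultimately show "gt d (f q) (J \<alpha> d (f q) v) w = - gt d (f q) v (J \<alpha> d (f q) w)" for v w
      using d q(2)[OF U] by blast
    show "linear (\<omega> \<alpha> d (f q))"
      using connection[THEN conjunct1, rule_format, OF \<alpha>] d q(5)[OF U] unfolding one_form_on_def by blast
  next
    have "DIM('b) = 4 * n" using ambient' by blast
    then show "DIM('b) = 2 * DIM('a)" using dim by simp
    show "3 \<le> DIM('a) \<or> (\<forall>q\<in>U. \<forall>u w. nabla_endo gt d (J 1) (f q) (tangent q u) w = 0)"
    proof (cases "n = 1")
      case True
      then show ?thesis using parallel by blast
    next
      case False
      then have "3 \<le> DIM('a)" using dim DIM_positive[where 'a = 'a] by linarith
      then show ?thesis ..
    qed
  qed (rule eps)

  have "p \<in> U" using p by (simp add: U_def)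
  then show "(\<forall>u v. differential c d f p (shape_tensor c d f gt J p u v)
             = J 2 d (f p) (second_fundamental_form c d f gt p u v)) \<and>
      shape_tensor c d f gt J p \<in> S_prolongation (g c p) (JT c p) \<and>
      (\<forall>u v w. differential c d f p (nabla_shape c d f gt g J p u v w)
             = J 2 d (f p) (nabla_h c d f gt g p u v w)
               + (\<epsilon> * \<omega> 1 d (f p) (differential c d f p u)) *\<^sub>R
                   differential c d f p (JT c p (shape_tensor c d f gt J p v w)))"
    using tangent_shape shape_in_prolongation nabla_shape_formula by blast
qed

end
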